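(* Let $n$ be a positive integer and let $J$ denote the Jacobson radical of the complex semigroup algebra $\mathbb{C}[\mathcal{FP}^+(S_n)]$. Then $\mathbb{C}[\mathcal{FP}^+(S_n)]/J\cong\mathbb{C}[\mathcal{F}_n^*]$.
   Context: $\mathcal{FP}^+(S_n)$ is the finite monoid whose elements are the classes $\overline{A}$ of nonempty subsets $A\subset S_n$ under the congruence $A\sim B$ iff $\{a(m)\mid a\in A\}=\{b(m)\mid b\in B\}$ for all $m\in\{1,\dots,n\}$, with multiplication $\overline{A}\,\overline{B}=\overline{AB}$, where $AB=\{ab\mid a\in A,b\in B\}$. $\mathcal{F}_n^*$ (the maximal factorizable submonoid of the dual symmetric inverse monoid) is the set of all binary relations on $\{1,\dots,n\}$ of the form $\rho\sigma$, where $\rho$ is an equivalence relation and $\sigma\in S_n$ (products of binary relations, composed as maps from right to left, so that $\rho\sigma$ relates each $m$ to all elements of the $\rho$-block of $\sigma(m)$), with multiplication $$\rho_1\sigma_1\bullet\rho_2\sigma_2=\overline{\rho_1\sigma_1\rho_2\sigma_1^{-1}}\,\sigma_1\sigma_2,$$ where here $\overline{\rho_1\sigma_1\rho_2\sigma_1^{-1}}$ denotes the minimal equivalence relation containing the binary relation $\rho_1\sigma_1\rho_2\sigma_1^{-1}$ (the product of the equivalence relations $\rho_1$ and $\sigma_1\rho_2\sigma_1^{-1}$). With this multiplication $\mathcal{F}_n^*$ is an inverse monoid. *)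

theory Defs
  imports Complex_Main "HOL-Algebra.QuotRing" "HOL-Algebra.Module" "HOL-Algebra.Sym_Groups"
begin

section \<open>Associative algebras over the complex numbers\<close>

text \<open>
  The record type of modules, which carries a ring structure together with a scalar
  multiplication, is used for unital, not necessarily commutative, complex algebras.
  (The locale \<^locale>\<open>algebra\<close> of the library only covers commutative ones.)
\<close>

type_synonym 'a calgebra = "(complex, 'a) module"

text \<open>
  Elements of the monoid algebra are the finitely supported functions on the monoid,
  vanishing outside its carrier so that they are determined by their restriction to it;
  \<open>f\<close> stands for the formal sum of the terms \<open>f x \<cdot> x\<close>.
\<close>

definition monoid_algebra :: "('a, 'b) monoid_scheme \<Rightarrow> ('a \<Rightarrow> complex) calgebra"
  where "monoid_algebra M =
    \<lparr>carrier = {f. finite {x. f x \<noteq> 0} \<and> {x. f x \<noteq> 0} \<subseteq> carrier M},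
     monoid.mult = (\<lambda>f g x. \<Sum>(a, b) \<in> {(a, b). f a \<noteq> 0 \<and> g b \<noteq> 0 \<and> a \<otimes>\<^bsub>M\<^esub> b = x}. f a * g b),
     one = (\<lambda>x. if x = \<one>\<^bsub>M\<^esub> then 1 else 0),
     zero = (\<lambda>x. 0),
     add = (\<lambda>f g x. f x + g x),
     smult = (\<lambda>c f x. c * f x)\<rparr>"

definition left_ideal :: "'a set \<Rightarrow> ('a, 'b) ring_scheme \<Rightarrow> bool"
  where "left_ideal I R \<longleftrightarrow>
    additive_subgroup I R \<and> (\<forall>r \<in> carrier R. \<forall>x \<in> I. r \<otimes>\<^bsub>R\<^esub> x \<in> I)"

definition maximal_left_ideal :: "'a set \<Rightarrow> ('a, 'b) ring_scheme \<Rightarrow> bool"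
  where "maximal_left_ideal I R \<longleftrightarrow>
    left_ideal I R \<and> I \<noteq> carrier R \<and>
    (\<forall>L. left_ideal L R \<and> I \<subseteq> L \<longrightarrow> L = I \<or> L = carrier R)"

definition jacobson_radical :: "('a, 'b) ring_scheme \<Rightarrow> 'a set"
  where "jacobson_radical R = carrier R \<inter> \<Inter> {I. maximal_left_ideal I R}"

text \<open>
  The quotient by a two-sided ideal: the quotient ring of the library, extended by the
  scalar multiplication \<open>c (I + x) = I + c x\<close>.
\<close>

definition quotient_algebra :: "'a calgebra \<Rightarrow> 'a set \<Rightarrow> 'a set calgebra"
  where "quotient_algebra A I =
    ring.extend (A Quot I) (module.fields (\<lambda>c X. \<Union>x \<in> X. I +>\<^bsub>A\<^esub> (c \<odot>\<^bsub>A\<^esub> x)))"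

definition algebra_iso :: "'a calgebra \<Rightarrow> 'b calgebra \<Rightarrow> ('a \<Rightarrow> 'b) set"
  where "algebra_iso A B =
    {h \<in> ring_iso A B. \<forall>c. \<forall>x \<in> carrier A. h (c \<odot>\<^bsub>A\<^esub> x) = c \<odot>\<^bsub>B\<^esub> h x}"

definition is_algebra_iso :: "'a calgebra \<Rightarrow> 'b calgebra \<Rightarrow> bool"
  where "is_algebra_iso A B \<longleftrightarrow> algebra_iso A B \<noteq> {}"


section \<open>The monoid of classes of nonempty subsets of the symmetric group\<close>

definition FP_rel :: "nat \<Rightarrow> ((nat \<Rightarrow> nat) set \<times> (nat \<Rightarrow> nat) set) set"
  where "FP_rel n =
    {(A, B). A \<subseteq> carrier (sym_group n) \<and> A \<noteq> {} \<and> B \<subseteq> carrier (sym_group n) \<and> B \<noteq> {} \<and>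
      (\<forall>m \<in> {1..n}. {a m |a. a \<in> A} = {b m |b. b \<in> B})}"

definition FP :: "nat \<Rightarrow> (nat \<Rightarrow> nat) set set monoid"
  where "FP n =
    \<lparr>carrier = {A. A \<subseteq> carrier (sym_group n) \<and> A \<noteq> {}} // FP_rel n,
     monoid.mult = (\<lambda>X Y. \<Union>A \<in> X. \<Union>B \<in> Y. FP_rel n `` {A <#>\<^bsub>sym_group n\<^esub> B}),
     one = FP_rel n `` {{\<one>\<^bsub>sym_group n\<^esub>}}\<rparr>"

lemma equiv_FP_rel: "equiv {A. A \<subseteq> carrier (sym_group n) \<and> A \<noteq> {}} (FP_rel n)"
  by (auto simp: equiv_def refl_on_def sym_def trans_def FP_rel_def)

lemma FP_rel_set_mult:
  assumes "(A, A') \<in> FP_rel n" "(B, B') \<in> FP_rel n"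
  shows "(A <#>\<^bsub>sym_group n\<^esub> B, A' <#>\<^bsub>sym_group n\<^esub> B') \<in> FP_rel n"
proof -
  have *: "{c m |c. c \<in> C <#>\<^bsub>sym_group n\<^esub> D} = (\<Union>k \<in> {d m |d. d \<in> D}. {c k |c. c \<in> C})"
    for C D and m :: nat
  proof -
    have "C <#>\<^bsub>sym_group n\<^esub> D = (\<Union>d \<in> D. (\<lambda>c. c \<circ> d) ` C)"
      by (auto simp: set_mult_def sym_group_def)
    then show ?thesis
      unfolding Setcompr_eq_image by (simp add: image_UN image_image)
  qed
  have sub: "A \<subseteq> carrier (sym_group n)" "A' \<subseteq> carrier (sym_group n)"
      "B \<subseteq> carrier (sym_group n)" "B' \<subseteq> carrier (sym_group n)"
    and ne: "A \<noteq> {}" "A' \<noteq> {}" "B \<noteq> {}" "B' \<noteq> {}"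
    and eqA: "\<And>m. m \<in> {1..n} \<Longrightarrow> {a m |a. a \<in> A} = {a m |a. a \<in> A'}"
    and eqB: "\<And>m. m \<in> {1..n} \<Longrightarrow> {b m |b. b \<in> B} = {b m |b. b \<in> B'}"
    using assms unfolding FP_rel_def by simp_all
  have **: "C <#>\<^bsub>sym_group n\<^esub> D \<subseteq> carrier (sym_group n)"
    if "C \<subseteq> carrier (sym_group n)" "D \<subseteq> carrier (sym_group n)" for C D
    by (rule monoid.set_mult_closed[OF group.is_monoid[OF sym_group_is_group] that])
  have ***: "C <#>\<^bsub>sym_group n\<^esub> D \<noteq> {}" if "C \<noteq> {}" "D \<noteq> {}" for C D
    using that unfolding set_mult_def by simp
  have "(\<Union>k \<in> {b m |b. b \<in> B}. {a k |a. a \<in> A}) = (\<Union>k \<in> {b m |b. b \<in> B'}. {a k |a. a \<in> A'})"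
    if m: "m \<in> {1..n}" for m
  proof (rule SUP_cong[OF eqB[OF m] eqA])
    fix k assume "k \<in> {b m |b. b \<in> B'}"
    then obtain b where "b \<in> B'" "k = b m" by blast
    moreover have "b permutes {1..n}"
      using \<open>b \<in> B'\<close> sub(4) sym_group_carrier by blast
    ultimately show "k \<in> {1..n}"
      using m permutes_in_image[of b "{1..n}" m] by simp
  qed
  then have "\<forall>m \<in> {1..n}. {c m |c. c \<in> A <#>\<^bsub>sym_group n\<^esub> B} = {c m |c. c \<in> A' <#>\<^bsub>sym_group n\<^esub> B'}"
    unfolding * by simp
  moreover note **[OF sub(1,3)] **[OF sub(2,4)] ***[OF ne(1,3)] ***[OF ne(2,4)]
  ultimately show ?thesis
    unfolding FP_rel_def by simp
qed

lemma FP_mult_class: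
  assumes "A \<subseteq> carrier (sym_group n)" "A \<noteq> {}" "B \<subseteq> carrier (sym_group n)" "B \<noteq> {}"
  shows "FP_rel n `` {A} \<otimes>\<^bsub>FP n\<^esub> FP_rel n `` {B} = FP_rel n `` {A <#>\<^bsub>sym_group n\<^esub> B}"
proof -
  define X Y Z where "X = FP_rel n `` {A}" and "Y = FP_rel n `` {B}"
    and "Z = FP_rel n `` {A <#>\<^bsub>sym_group n\<^esub> B}"
  have Z: "FP_rel n `` {A' <#>\<^bsub>sym_group n\<^esub> B'} = Z" if "A' \<in> X" "B' \<in> Y" for A' B'
    unfolding Z_def
  proof (rule equiv_class_eq[OF equiv_FP_rel, symmetric])
    show "(A <#>\<^bsub>sym_group n\<^esub> B, A' <#>\<^bsub>sym_group n\<^esub> B') \<in> FP_rel n"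
      using that unfolding X_def Y_def Image_singleton_iff by (rule FP_rel_set_mult)
  qed
  have "A \<in> X" "B \<in> Y"
    using assms by (simp_all add: X_def Y_def FP_rel_def)
  then have ne: "X \<noteq> {}" "Y \<noteq> {}"
    by blast+
  have "X \<otimes>\<^bsub>FP n\<^esub> Y = (\<Union>A' \<in> X. \<Union>B' \<in> Y. FP_rel n `` {A' <#>\<^bsub>sym_group n\<^esub> B'})"
    by (simp only: FP_def monoid.simps)
  also have "\<dots> = (\<Union>A' \<in> X. \<Union>B' \<in> Y. Z)"
    by (intro SUP_cong refl Z)
  also have "\<dots> = Z"
    using ne by (simp only: UN_constant if_False)
  finally show ?thesis
    unfolding X_def Y_def Z_def .
qed


section \<open>The maximal factorizable submonoid of the dual symmetric inverse monoid\<close>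

text \<open>
  Binary relations are multiplied like maps, from right to left, whereas \<^term>\<open>r O s\<close>
  applies \<open>r\<close> first.
\<close>

definition rel_prod :: "('b \<times> 'c) set \<Rightarrow> ('a \<times> 'b) set \<Rightarrow> ('a \<times> 'c) set" (infixl "\<cdot>\<^sub>r" 75)
  where "r \<cdot>\<^sub>r s = s O r"

definition perm_rel :: "nat \<Rightarrow> (nat \<Rightarrow> nat) \<Rightarrow> (nat \<times> nat) set"
  where "perm_rel n \<sigma> = {(m, \<sigma> m) |m. m \<in> {1..n}}"

definition equiv_hull :: "nat \<Rightarrow> (nat \<times> nat) set \<Rightarrow> (nat \<times> nat) set"
  where "equiv_hull n r = \<Inter> {\<epsilon>. equiv {1..n} \<epsilon> \<and> r \<subseteq> \<epsilon>}"

text \<open>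
  The multiplication is given in terms of factorizations \<open>\<rho>\<sigma>\<close> of its arguments. The
  permutation \<open>\<sigma>\<close> is not determined by the product, but the result does not depend on its
  choice; see \<open>dual_mult_eq\<close> below.
\<close>

definition dual_mult :: "nat \<Rightarrow> (nat \<times> nat) set \<Rightarrow> (nat \<times> nat) set \<Rightarrow> (nat \<times> nat) set"
  where "dual_mult n r s =
    (THE t. \<exists>\<rho>\<^sub>1 \<sigma>\<^sub>1 \<rho>\<^sub>2 \<sigma>\<^sub>2.
      equiv {1..n} \<rho>\<^sub>1 \<and> \<sigma>\<^sub>1 \<in> carrier (sym_group n) \<and> r = \<rho>\<^sub>1 \<cdot>\<^sub>r perm_rel n \<sigma>\<^sub>1 \<and>
      equiv {1..n} \<rho>\<^sub>2 \<and> \<sigma>\<^sub>2 \<in> carrier (sym_group n) \<and> s = \<rho>\<^sub>2 \<cdot>\<^sub>r perm_rel n \<sigma>\<^sub>2 \<and>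
      t = equiv_hull n (\<rho>\<^sub>1 \<cdot>\<^sub>r perm_rel n \<sigma>\<^sub>1 \<cdot>\<^sub>r \<rho>\<^sub>2 \<cdot>\<^sub>r perm_rel n (inv' \<sigma>\<^sub>1))
            \<cdot>\<^sub>r perm_rel n (\<sigma>\<^sub>1 \<otimes>\<^bsub>sym_group n\<^esub> \<sigma>\<^sub>2))"

definition factorizable_dual :: "nat \<Rightarrow> (nat \<times> nat) set monoid"
  where "factorizable_dual n =
    \<lparr>carrier = {\<rho> \<cdot>\<^sub>r perm_rel n \<sigma> |\<rho> \<sigma>. equiv {1..n} \<rho> \<and> \<sigma> \<in> carrier (sym_group n)},
     monoid.mult = dual_mult n,
     one = Id_on {1..n}\<rparr>"

lemma equiv_equiv_hull:
  assumes "r \<subseteq> {1..n} \<times> {1..n}"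
  shows "equiv {1..n} (equiv_hull n r)"
proof -
  define \<E> where "\<E> = {\<epsilon>. equiv {1..n} \<epsilon> \<and> r \<subseteq> \<epsilon>}"
  have "equiv {1..n} ({1..n} \<times> {1..n})"
    by (intro equivI refl_onI symI transI) auto
  then have "{1..n} \<times> {1..n} \<in> \<E>"
    using assms unfolding \<E>_def by blast
  then have "\<Inter>\<E> \<subseteq> {1..n} \<times> {1..n}"
    by (rule Inter_lower)
  moreover have \<E>: "refl_on {1..n} \<epsilon>" "sym \<epsilon>" "trans \<epsilon>" if "\<epsilon> \<in> \<E>" for \<epsilon>
    using that unfolding \<E>_def equiv_def by simp_all
  have "refl_on {1..n} (\<Inter>\<E>)"
    using \<E>(1) by (intro refl_onI InterI) (rule refl_onD)
  moreover have "sym (\<Inter>\<E>)"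
    using \<E>(2) by (intro symI InterI) (metis InterD symD)
  moreover have "trans (\<Inter>\<E>)"
    using \<E>(3) by (intro transI InterI) (metis InterD transD)
  ultimately show ?thesis
    unfolding equiv_hull_def \<E>_def[symmetric] by (rule equivI)
qed

lemma mem_rel_perm:
  "(m, k) \<in> \<rho> \<cdot>\<^sub>r perm_rel n \<sigma> \<longleftrightarrow> m \<in> {1..n} \<and> (\<sigma> m, k) \<in> \<rho>"
  by (auto simp: rel_prod_def perm_rel_def)

lemma mem_conj:
  assumes "\<sigma> permutes {1..n}"
  shows "(x, y) \<in> \<rho>\<^sub>1 \<cdot>\<^sub>r perm_rel n \<sigma> \<cdot>\<^sub>r \<rho>\<^sub>2 \<cdot>\<^sub>r perm_rel n (inv' \<sigma>) \<longleftrightarrow>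
    (\<exists>a b. a \<in> {1..n} \<and> b \<in> {1..n} \<and> x = \<sigma> a \<and> (a, b) \<in> \<rho>\<^sub>2 \<and> (\<sigma> b, y) \<in> \<rho>\<^sub>1)"
proof -
  have "(x, y) \<in> \<rho>\<^sub>1 \<cdot>\<^sub>r perm_rel n \<sigma> \<cdot>\<^sub>r \<rho>\<^sub>2 \<cdot>\<^sub>r perm_rel n (inv' \<sigma>) \<longleftrightarrow>
      x \<in> {1..n} \<and> (\<exists>b. (inv' \<sigma> x, b) \<in> \<rho>\<^sub>2 \<and> b \<in> {1..n} \<and> (\<sigma> b, y) \<in> \<rho>\<^sub>1)"
    unfolding mem_rel_perm unfolding rel_prod_def perm_rel_def by blast
  also have "\<dots> \<longleftrightarrow> (\<exists>a b. a \<in> {1..n} \<and> b \<in> {1..n} \<and> x = \<sigma> a \<and> (a, b) \<in> \<rho>\<^sub>2 \<and> (\<sigma> b, y) \<in> \<rho>\<^sub>1)"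
    using permutes_inverses[OF assms] permutes_in_image[OF assms] by metis
  finally show ?thesis .
qed

lemma dual_mult_eq:
  assumes "equiv {1..n} \<rho>\<^sub>1" "\<sigma>\<^sub>1 \<in> carrier (sym_group n)"
    and "equiv {1..n} \<rho>\<^sub>2" "\<sigma>\<^sub>2 \<in> carrier (sym_group n)"
  shows "dual_mult n (\<rho>\<^sub>1 \<cdot>\<^sub>r perm_rel n \<sigma>\<^sub>1) (\<rho>\<^sub>2 \<cdot>\<^sub>r perm_rel n \<sigma>\<^sub>2) =
    equiv_hull n (\<rho>\<^sub>1 \<cdot>\<^sub>r perm_rel n \<sigma>\<^sub>1 \<cdot>\<^sub>r \<rho>\<^sub>2 \<cdot>\<^sub>r perm_rel n (inv' \<sigma>\<^sub>1))
      \<cdot>\<^sub>r perm_rel n (\<sigma>\<^sub>1 \<otimes>\<^bsub>sym_group n\<^esub> \<sigma>\<^sub>2)"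
proof -
  define conj where "conj \<rho> \<sigma> \<tau> = \<rho> \<cdot>\<^sub>r perm_rel n \<sigma> \<cdot>\<^sub>r \<tau> \<cdot>\<^sub>r perm_rel n (inv' \<sigma>)"
    for \<rho> \<tau> :: "(nat \<times> nat) set" and \<sigma>
  have factor: "\<rho>' = \<rho> \<and> (\<forall>m \<in> {1..n}. (\<sigma> m, \<sigma>' m) \<in> \<rho>)"
    if \<rho>: "equiv {1..n} \<rho>" "equiv {1..n} \<rho>'" and \<sigma>: "\<sigma> permutes {1..n}" "\<sigma>' permutes {1..n}"
      and eq: "\<rho> \<cdot>\<^sub>r perm_rel n \<sigma> = \<rho>' \<cdot>\<^sub>r perm_rel n \<sigma>'" for \<rho> \<rho>' \<sigma> \<sigma>'
  proof -
    have sub: "\<tau>' \<subseteq> \<tau>"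
      if t: "equiv {1..n} \<tau>" "equiv {1..n} \<tau>'" "\<pi>' permutes {1..n}"
        "\<tau> \<cdot>\<^sub>r perm_rel n \<pi> = \<tau>' \<cdot>\<^sub>r perm_rel n \<pi>'" for \<tau> \<tau>' \<pi> \<pi>'
    proof (rule subrelI)
      fix x y assume xy: "(x, y) \<in> \<tau>'"
      then have "x \<in> {1..n}" "y \<in> {1..n}"
        using t(2) by (auto simp: equiv_def)
      then obtain m where m: "m \<in> {1..n}" "x = \<pi>' m"
        using permutes_image[OF t(3)] by blast
      have "(x, x) \<in> \<tau>'"
        using \<open>x \<in> {1..n}\<close> t(2) by (auto simp: equiv_def refl_on_def)
      then have "(m, x) \<in> \<tau> \<cdot>\<^sub>r perm_rel n \<pi>" "(m, y) \<in> \<tau> \<cdot>\<^sub>r perm_rel n \<pi>"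
        unfolding t(4) mem_rel_perm using m xy by auto
      then show "(x, y) \<in> \<tau>"
        using t(1) unfolding mem_rel_perm equiv_def by (meson symD transD)
    qed
    have "\<rho>' = \<rho>"
      using sub[OF \<rho>(1,2) \<sigma>(2) eq] sub[OF \<rho>(2,1) \<sigma>(1) eq[symmetric]] by blast
    moreover have "(\<sigma> m, \<sigma>' m) \<in> \<rho>" if m: "m \<in> {1..n}" for m
    proof -
      have "(\<sigma>' m, \<sigma>' m) \<in> \<rho>'"
        using m permutes_in_image[OF \<sigma>(2)] \<open>equiv {1..n} \<rho>'\<close> by (auto simp: equiv_def refl_on_def)
      then have "(m, \<sigma>' m) \<in> \<rho> \<cdot>\<^sub>r perm_rel n \<sigma>"
        unfolding eq mem_rel_perm using m by simp
      then show ?thesis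
        by (simp add: mem_rel_perm)
    qed
    ultimately show ?thesis by blast
  qed
  have conj_sub: "conj \<rho> \<sigma> \<tau> \<subseteq> {1..n} \<times> {1..n}"
    if "equiv {1..n} \<rho>" "\<sigma> permutes {1..n}" for \<rho> \<sigma> \<tau>
  proof (rule subrelI)
    fix x y assume "(x, y) \<in> conj \<rho> \<sigma> \<tau>"
    then obtain a b where ab: "a \<in> {1..n}" "x = \<sigma> a" "(\<sigma> b, y) \<in> \<rho>"
      unfolding conj_def mem_conj[OF \<open>\<sigma> permutes {1..n}\<close>] by blast
    have "x \<in> {1..n}"
      using ab permutes_in_image[OF \<open>\<sigma> permutes {1..n}\<close>] by simp
    moreover have "y \<in> {1..n}"
      using ab(3) \<open>equiv {1..n} \<rho>\<close> by (auto simp: equiv_def)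
    ultimately show "(x, y) \<in> {1..n} \<times> {1..n}" by blast
  qed
  have parts: "\<rho> \<subseteq> conj \<rho> \<sigma> \<tau>" "a \<in> {1..n} \<Longrightarrow> b \<in> {1..n} \<Longrightarrow> (a, b) \<in> \<tau> \<Longrightarrow> (\<sigma> a, \<sigma> b) \<in> conj \<rho> \<sigma> \<tau>"
    if t: "equiv {1..n} \<rho>" "equiv {1..n} \<tau>" "\<sigma> permutes {1..n}" for \<rho> \<sigma> \<tau> a b
  proof -
    show "\<rho> \<subseteq> conj \<rho> \<sigma> \<tau>"
    proof (rule subrelI)
      fix x y assume xy: "(x, y) \<in> \<rho>"
      then have "x \<in> {1..n}"
        using t(1) by (auto simp: equiv_def)
      then obtain m where "m \<in> {1..n}" "x = \<sigma> m"
        using permutes_image[OF t(3)] by blast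
      then show "(x, y) \<in> conj \<rho> \<sigma> \<tau>"
        using xy t(2) unfolding conj_def mem_conj[OF t(3)] equiv_def refl_on_def by blast
    qed
    show "(\<sigma> a, \<sigma> b) \<in> conj \<rho> \<sigma> \<tau>" if ab: "a \<in> {1..n}" "b \<in> {1..n}" "(a, b) \<in> \<tau>"
    proof -
      have "(\<sigma> b, \<sigma> b) \<in> \<rho>"
        using ab(2) \<open>equiv {1..n} \<rho>\<close> permutes_in_image[OF \<open>\<sigma> permutes {1..n}\<close>]
        by (auto simp: equiv_def refl_on_def)
      then show ?thesis
        using ab unfolding conj_def mem_conj[OF \<open>\<sigma> permutes {1..n}\<close>] by blast
    qed
  qed
  have hull_sub: "equiv_hull n (conj \<rho> \<sigma> \<tau>) \<subseteq> equiv_hull n (conj \<rho> \<sigma>' \<tau>)"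
    if "equiv {1..n} \<rho>" "equiv {1..n} \<tau>" "\<sigma> permutes {1..n}" "\<sigma>' permutes {1..n}"
      and close: "\<And>m. m \<in> {1..n} \<Longrightarrow> (\<sigma> m, \<sigma>' m) \<in> \<rho>" for \<rho> \<tau> \<sigma> \<sigma>'
  proof -
    have "conj \<rho> \<sigma> \<tau> \<subseteq> \<epsilon>" if \<epsilon>: "equiv {1..n} \<epsilon>" "conj \<rho> \<sigma>' \<tau> \<subseteq> \<epsilon>" for \<epsilon>
    proof (rule subrelI)
      fix x y assume "(x, y) \<in> conj \<rho> \<sigma> \<tau>"
      then obtain a b where ab: "a \<in> {1..n}" "b \<in> {1..n}" "x = \<sigma> a" "(a, b) \<in> \<tau>" "(\<sigma> b, y) \<in> \<rho>"
        unfolding conj_def mem_conj[OF \<open>\<sigma> permutes {1..n}\<close>] by blast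
      have "\<rho> \<subseteq> \<epsilon>"
        using parts(1)[OF \<open>equiv {1..n} \<rho>\<close> \<open>equiv {1..n} \<tau>\<close> \<open>\<sigma>' permutes {1..n}\<close>] \<epsilon>(2) by blast
      then have "(x, \<sigma>' a) \<in> \<epsilon>" "(\<sigma> b, \<sigma>' b) \<in> \<epsilon>" "(\<sigma> b, y) \<in> \<epsilon>"
        using close ab by auto
      moreover have "(\<sigma>' a, \<sigma>' b) \<in> \<epsilon>"
        using parts(2)[OF \<open>equiv {1..n} \<rho>\<close> \<open>equiv {1..n} \<tau>\<close> \<open>\<sigma>' permutes {1..n}\<close>] ab \<epsilon>(2) by blast
      ultimately show "(x, y) \<in> \<epsilon>"
        using \<epsilon>(1) unfolding equiv_def by (meson symD transD)
    qed
    then show ?thesis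
      unfolding equiv_hull_def by blast
  qed
  have unique: "equiv_hull n (conj \<rho>\<^sub>1' \<sigma>\<^sub>1' \<rho>\<^sub>2') \<cdot>\<^sub>r perm_rel n (\<sigma>\<^sub>1' \<circ> \<sigma>\<^sub>2') =
      equiv_hull n (conj \<rho>\<^sub>1 \<sigma>\<^sub>1 \<rho>\<^sub>2) \<cdot>\<^sub>r perm_rel n (\<sigma>\<^sub>1 \<circ> \<sigma>\<^sub>2)"
    if prem: "equiv {1..n} \<rho>\<^sub>1'" "\<sigma>\<^sub>1' permutes {1..n}"
        "\<rho>\<^sub>1 \<cdot>\<^sub>r perm_rel n \<sigma>\<^sub>1 = \<rho>\<^sub>1' \<cdot>\<^sub>r perm_rel n \<sigma>\<^sub>1'"
        "equiv {1..n} \<rho>\<^sub>2'" "\<sigma>\<^sub>2' permutes {1..n}"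
        "\<rho>\<^sub>2 \<cdot>\<^sub>r perm_rel n \<sigma>\<^sub>2 = \<rho>\<^sub>2' \<cdot>\<^sub>r perm_rel n \<sigma>\<^sub>2'" for \<rho>\<^sub>1' \<sigma>\<^sub>1' \<rho>\<^sub>2' \<sigma>\<^sub>2'
  proof -
    have \<sigma>: "\<sigma>\<^sub>1 permutes {1..n}" "\<sigma>\<^sub>2 permutes {1..n}"
      using assms(2,4) by (auto simp: sym_group_carrier)
    have f1: "\<rho>\<^sub>1' = \<rho>\<^sub>1" "\<And>m. m \<in> {1..n} \<Longrightarrow> (\<sigma>\<^sub>1 m, \<sigma>\<^sub>1' m) \<in> \<rho>\<^sub>1"
      using factor[OF assms(1) prem(1) \<sigma>(1) prem(2) prem(3)] by auto
    have f2: "\<rho>\<^sub>2' = \<rho>\<^sub>2" "\<And>m. m \<in> {1..n} \<Longrightarrow> (\<sigma>\<^sub>2 m, \<sigma>\<^sub>2' m) \<in> \<rho>\<^sub>2"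
      using factor[OF assms(3) prem(4) \<sigma>(2) prem(5) prem(6)] by auto
    define \<epsilon> where "\<epsilon> = equiv_hull n (conj \<rho>\<^sub>1 \<sigma>\<^sub>1 \<rho>\<^sub>2)"
    have f1': "(\<sigma>\<^sub>1' m, \<sigma>\<^sub>1 m) \<in> \<rho>\<^sub>1" if "m \<in> {1..n}" for m
      using f1(2)[OF that] assms(1) by (auto simp: equiv_def dest: symD)
    have hull: "equiv_hull n (conj \<rho>\<^sub>1 \<sigma>\<^sub>1' \<rho>\<^sub>2) = \<epsilon>"
      unfolding \<epsilon>_def
      using hull_sub[OF assms(1,3) \<sigma>(1) prem(2) f1(2)] hull_sub[OF assms(1,3) prem(2) \<sigma>(1) f1'] by blast
    have \<epsilon>: "equiv {1..n} \<epsilon>"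
      unfolding \<epsilon>_def by (intro equiv_equiv_hull conj_sub assms(1) \<sigma>)
    have sub: "conj \<rho>\<^sub>1 \<sigma>\<^sub>1 \<rho>\<^sub>2 \<subseteq> \<epsilon>"
      unfolding \<epsilon>_def equiv_hull_def by blast
    have close: "(\<sigma>\<^sub>1 (\<sigma>\<^sub>2 m), \<sigma>\<^sub>1' (\<sigma>\<^sub>2' m)) \<in> \<epsilon>" if m: "m \<in> {1..n}" for m
    proof -
      have m': "\<sigma>\<^sub>2 m \<in> {1..n}" "\<sigma>\<^sub>2' m \<in> {1..n}"
        using m permutes_in_image[OF \<sigma>(2)] permutes_in_image[OF prem(5)] by auto
      have "(\<sigma>\<^sub>1 (\<sigma>\<^sub>2 m), \<sigma>\<^sub>1 (\<sigma>\<^sub>2' m)) \<in> \<epsilon>"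
        using parts(2)[OF assms(1,3) \<sigma>(1) m' f2(2)[OF m]] sub by blast
      moreover have "(\<sigma>\<^sub>1 (\<sigma>\<^sub>2' m), \<sigma>\<^sub>1' (\<sigma>\<^sub>2' m)) \<in> \<epsilon>"
        using parts(1)[OF assms(1,3) \<sigma>(1)] f1(2)[OF m'(2)] sub by blast
      ultimately show ?thesis
        using \<epsilon> unfolding equiv_def by (meson transD)
    qed
    have "(m, k) \<in> \<epsilon> \<cdot>\<^sub>r perm_rel n (\<sigma>\<^sub>1' \<circ> \<sigma>\<^sub>2') \<longleftrightarrow> (m, k) \<in> \<epsilon> \<cdot>\<^sub>r perm_rel n (\<sigma>\<^sub>1 \<circ> \<sigma>\<^sub>2)" for m k
      unfolding mem_rel_perm comp_apply using close[of m] \<epsilon> unfolding equiv_def by (meson symD transD)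
    then show ?thesis
      unfolding f1(1) f2(1) hull unfolding \<epsilon>_def by auto
  qed
  show ?thesis
    unfolding dual_mult_def
  proof (rule the_equality)
    fix t
    assume "\<exists>\<rho>\<^sub>1' \<sigma>\<^sub>1' \<rho>\<^sub>2' \<sigma>\<^sub>2'.
      equiv {1..n} \<rho>\<^sub>1' \<and> \<sigma>\<^sub>1' \<in> carrier (sym_group n) \<and>
      \<rho>\<^sub>1 \<cdot>\<^sub>r perm_rel n \<sigma>\<^sub>1 = \<rho>\<^sub>1' \<cdot>\<^sub>r perm_rel n \<sigma>\<^sub>1' \<and>
      equiv {1..n} \<rho>\<^sub>2' \<and> \<sigma>\<^sub>2' \<in> carrier (sym_group n) \<and>
      \<rho>\<^sub>2 \<cdot>\<^sub>r perm_rel n \<sigma>\<^sub>2 = \<rho>\<^sub>2' \<cdot>\<^sub>r perm_rel n \<sigma>\<^sub>2' \<and>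
      t = equiv_hull n (\<rho>\<^sub>1' \<cdot>\<^sub>r perm_rel n \<sigma>\<^sub>1' \<cdot>\<^sub>r \<rho>\<^sub>2' \<cdot>\<^sub>r perm_rel n (inv' \<sigma>\<^sub>1'))
            \<cdot>\<^sub>r perm_rel n (\<sigma>\<^sub>1' \<otimes>\<^bsub>sym_group n\<^esub> \<sigma>\<^sub>2')"
    then show "t = equiv_hull n (\<rho>\<^sub>1 \<cdot>\<^sub>r perm_rel n \<sigma>\<^sub>1 \<cdot>\<^sub>r \<rho>\<^sub>2 \<cdot>\<^sub>r perm_rel n (inv' \<sigma>\<^sub>1))
            \<cdot>\<^sub>r perm_rel n (\<sigma>\<^sub>1 \<otimes>\<^bsub>sym_group n\<^esub> \<sigma>\<^sub>2)"
      unfolding sym_group_carrier sym_group_mult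
      by (elim exE conjE) (simp only: unique[unfolded conj_def])
  qed (rule exI[of _ \<rho>\<^sub>1], rule exI[of _ \<sigma>\<^sub>1], rule exI[of _ \<rho>\<^sub>2], rule exI[of _ \<sigma>\<^sub>2],
      intro conjI refl assms)
qed

end

theory Submission
  imports Defs
begin

text \<open>
  The class of a set \<open>A\<close> of permutations is determined by the union \<open>r\<close> of the graphs of its
  elements, and multiplication of classes becomes the product of relations. Sending \<open>r\<close> to
  the least element of the dual monoid containing it is a surjective homomorphism; let \<open>\<Phi>\<close> be
  its linear extension. The claim is that the radical is the kernel of \<open>\<Phi>\<close>.

  The kernel is nil: if the product \<open>p r\<close> is not larger than \<open>p\<close>, then it depends only on the
  image of \<open>r\<close>, so that right multiplication by an element of the kernel strictly raises the
  filtration by the cardinality of relations, which is bounded by \<open>n\<^sup>2\<close>.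

  Conversely, say that \<open>r\<close> intertwines \<open>f\<close> and \<open>g\<close> if \<open>g m = f k\<close> for all \<open>(m, k)\<close> in \<open>r\<close>. The
  0-1 matrices \<open>E r\<close> recording which pairs are intertwined by \<open>r\<close> form a representation, and
  the converse of \<open>r\<close> has the transposed matrix. For \<open>x\<close> in the radical with matrix \<open>H\<close>, the
  Hermitian matrix \<open>H\<^sup>* H\<close> comes from the radical too, hence is nilpotent, hence \<open>0\<close>; so
  \<open>H = 0\<close>. Finally the representation is faithful on the algebra of the dual monoid: for
  \<open>t = \<rho>\<sigma>\<close>, the functions \<open>f k = \<rho> `` {k}\<close> and \<open>g m = t `` {m}\<close> are intertwined exactly by the
  relations contained in \<open>t\<close>, and one inducts on the cardinality of \<open>t\<close>.
\<close>

section \<open>The Jacobson radical and left ideals\<close>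

lemma left_idealI:
  assumes "ring R" "I \<subseteq> carrier R" "\<zero>\<^bsub>R\<^esub> \<in> I"
    and "\<And>x y. x \<in> I \<Longrightarrow> y \<in> I \<Longrightarrow> x \<oplus>\<^bsub>R\<^esub> y \<in> I"
    and "\<And>r x. r \<in> carrier R \<Longrightarrow> x \<in> I \<Longrightarrow> r \<otimes>\<^bsub>R\<^esub> x \<in> I"
  shows "left_ideal I R"
proof -
  interpret ring R by fact
  \<comment> \<open>Negatives are left multiples by \<open>\<ominus> \<one>\<close>.\<close>
  have "\<ominus>\<^bsub>R\<^esub> x \<in> I" if "x \<in> I" for x
    using assms(5)[of "\<ominus>\<^bsub>R\<^esub> \<one>\<^bsub>R\<^esub>" x] that assms(2) by (simp add: l_minus subset_iff)
  then have "subgroup I (add_monoid R)"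
    using assms(2-4) by (intro add.subgroupI) (auto simp: a_inv_def)
  then show ?thesis
    using assms(5) by (simp add: left_ideal_def additive_subgroupI)
qed

lemma left_idealD:
  assumes "left_ideal I R"
  shows "I \<subseteq> carrier R" "\<zero>\<^bsub>R\<^esub> \<in> I"
    and "x \<in> I \<Longrightarrow> y \<in> I \<Longrightarrow> x \<oplus>\<^bsub>R\<^esub> y \<in> I"
    and "r \<in> carrier R \<Longrightarrow> x \<in> I \<Longrightarrow> r \<otimes>\<^bsub>R\<^esub> x \<in> I"
proof -
  interpret additive_subgroup I R
    using assms unfolding left_ideal_def by blast
  show "I \<subseteq> carrier R" "\<zero>\<^bsub>R\<^esub> \<in> I" "x \<in> I \<Longrightarrow> y \<in> I \<Longrightarrow> x \<oplus>\<^bsub>R\<^esub> y \<in> I"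
    using a_subset by auto
  show "r \<in> carrier R \<Longrightarrow> x \<in> I \<Longrightarrow> r \<otimes>\<^bsub>R\<^esub> x \<in> I"
    using assms unfolding left_ideal_def by blast
qed

lemma (in ring) left_ideal_eq_carrier:
  assumes "left_ideal I R" "\<one> \<in> I"
  shows "I = carrier R"
proof
  show "carrier R \<subseteq> I"
    using left_idealD(4)[OF assms(1) _ assms(2)] by auto
qed (rule left_idealD(1)[OF assms(1)])

text \<open>This is the left ideal \<open>I + R x\<close>. For zero \<open>I\<close> it is the
  principal left ideal of \<open>x\<close>; for maximal \<open>I\<close> and \<open>x\<close>
  outside \<open>I\<close> it is the whole ring.\<close>

lemma (in ring) left_ideal_add_principal:
  assumes I: "left_ideal I R" and x: "x \<in> carrier R"
  shows "left_ideal {i \<oplus> r \<otimes> x |i r. i \<in> I \<and> r \<in> carrier R} R" (is "left_ideal ?L R")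
    and "I \<subseteq> {i \<oplus> r \<otimes> x |i r. i \<in> I \<and> r \<in> carrier R}"
    and "x \<in> {i \<oplus> r \<otimes> x |i r. i \<in> I \<and> r \<in> carrier R}"
proof -
  note I' = left_idealD[OF I]
  show sub: "I \<subseteq> ?L"
  proof
    fix i assume "i \<in> I"
    then show "i \<in> ?L"
      using I'(1) x by (intro CollectI exI[of _ i] exI[of _ \<zero>]) auto
  qed
  show "x \<in> ?L"
    using I'(2) x by (intro CollectI exI[of _ \<zero>] exI[of _ \<one>]) auto
  show "left_ideal ?L R"
  proof (rule left_idealI[OF ring_axioms])
    show "?L \<subseteq> carrier R" "\<zero> \<in> ?L"
      using I'(1,2) x sub by auto
  next
    fix y z assume "y \<in> ?L" "z \<in> ?L"
    then obtain i r j s where *: "y = i \<oplus> r \<otimes> x" "z = j \<oplus> s \<otimes> x"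
      "i \<in> I" "j \<in> I" "r \<in> carrier R" "s \<in> carrier R" by blast
    have "y \<oplus> z = (i \<oplus> j) \<oplus> (r \<oplus> s) \<otimes> x"
      using * I'(1) x by (simp add: subset_iff l_distr a_ac)
    then show "y \<oplus> z \<in> ?L"
      using * I'(3) by blast
  next
    fix a y assume "a \<in> carrier R" "y \<in> ?L"
    then obtain i r where *: "y = i \<oplus> r \<otimes> x" "i \<in> I" "r \<in> carrier R" by blast
    then have "a \<otimes> y = a \<otimes> i \<oplus> (a \<otimes> r) \<otimes> x"
      using \<open>a \<in> carrier R\<close> I'(1) x by (simp add: subset_iff r_distr m_assoc)
    then show "a \<otimes> y \<in> ?L"
      using * I'(4) \<open>a \<in> carrier R\<close> by blast
  qed
qed

lemma (in ring) exists_maximal_left_ideal: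
  assumes L: "left_ideal L R" "L \<noteq> carrier R"
  obtains I where "maximal_left_ideal I R" "L \<subseteq> I"
proof -
  \<comment> \<open>Properness is written as \<open>\<one> \<notin> I\<close>, a condition that
    passes to unions of chains.\<close>
  define \<A> where "\<A> = {I. left_ideal I R \<and> \<one> \<notin> I \<and> L \<subseteq> I}"
  have "\<exists>I \<in> \<A>. \<forall>X \<in> \<A>. I \<subseteq> X \<longrightarrow> X = I"
  proof (rule subset_Zorn_nonempty)
    have "\<one> \<notin> L"
      using L left_ideal_eq_carrier by blast
    then show "\<A> \<noteq> {}"
      using L unfolding \<A>_def by blast
  next
    fix \<C> assume ne: "\<C> \<noteq> {}" and ch: "subset.chain \<A> \<C>"
    then have \<C>: "\<And>I. I \<in> \<C> \<Longrightarrow> left_ideal I R" "\<And>I. I \<in> \<C> \<Longrightarrow> \<one> \<notin> I" "\<And>I. I \<in> \<C> \<Longrightarrow> L \<subseteq> I"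
      and lin: "\<And>I I'. I \<in> \<C> \<Longrightarrow> I' \<in> \<C> \<Longrightarrow> I \<subseteq> I' \<or> I' \<subseteq> I"
      unfolding subset_chain_def \<A>_def by auto
    have "left_ideal (\<Union>\<C>) R"
    proof (rule left_idealI[OF ring_axioms])
      show "\<Union>\<C> \<subseteq> carrier R"
        using left_idealD(1)[OF \<C>(1)] by blast
      show "\<zero> \<in> \<Union>\<C>"
        using left_idealD(2)[OF \<C>(1)] ne by blast
    next
      fix x y assume "x \<in> \<Union>\<C>" "y \<in> \<Union>\<C>"
      then obtain I where "I \<in> \<C>" "x \<in> I" "y \<in> I"
        using lin by blast
      then show "x \<oplus> y \<in> \<Union>\<C>"
        using left_idealD(3)[OF \<C>(1)] by blast
    next
      fix r x assume "r \<in> carrier R" "x \<in> \<Union>\<C>"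
      then show "r \<otimes> x \<in> \<Union>\<C>"
        using left_idealD(4)[OF \<C>(1)] by blast
    qed
    then show "\<Union>\<C> \<in> \<A>"
      using \<C> ne unfolding \<A>_def by blast
  qed
  then obtain I where I: "I \<in> \<A>" and max: "\<And>X. X \<in> \<A> \<Longrightarrow> I \<subseteq> X \<Longrightarrow> X = I"
    by blast
  have "maximal_left_ideal I R"
    unfolding maximal_left_ideal_def
    using I max left_ideal_eq_carrier unfolding \<A>_def by auto
  then show ?thesis
    using I that unfolding \<A>_def by blast
qed

section \<open>Left inverses and nil left ideals\<close>

lemma (in ring) jacobson_radical_mult_left:
  assumes "x \<in> jacobson_radical R" "r \<in> carrier R"
  shows "r \<otimes> x \<in> jacobson_radical R"
  using assms left_idealD(4)[of _ R r x]
  unfolding jacobson_radical_def maximal_left_ideal_def by auto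

text \<open>A maximal left ideal above \<open>R (\<one> \<ominus> x)\<close> would also contain
  \<open>x\<close>, hence \<open>\<one>\<close>; so this left ideal is the whole ring.\<close>

lemma (in ring) jacobson_radical_left_inverse:
  assumes x: "x \<in> jacobson_radical R"
  obtains u where "u \<in> carrier R" "u \<otimes> (\<one> \<ominus> x) = \<one>"
proof -
  have xc: "x \<in> carrier R"
    using x by (simp add: jacobson_radical_def)
  define L where "L = {i \<oplus> r \<otimes> (\<one> \<ominus> x) |i r. i \<in> {\<zero>} \<and> r \<in> carrier R}"
  have zero: "left_ideal {\<zero>} R"
    by (rule left_idealI[OF ring_axioms]) auto
  have L: "left_ideal L R" "\<one> \<ominus> x \<in> L"
    using left_ideal_add_principal[OF zero, of "\<one> \<ominus> x"] xc unfolding L_def by auto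
  have "L = carrier R"
  proof (rule ccontr)
    assume "L \<noteq> carrier R"
    then obtain I where I: "maximal_left_ideal I R" "L \<subseteq> I"
      using exists_maximal_left_ideal L(1) by blast
    then have I': "left_ideal I R" "I \<noteq> carrier R" and "x \<in> I"
      using x unfolding maximal_left_ideal_def jacobson_radical_def by auto
    have "(\<one> \<ominus> x) \<oplus> x \<in> I"
      using L(2) I(2) \<open>x \<in> I\<close> left_idealD(3)[OF I'(1)] by blast
    also have "(\<one> \<ominus> x) \<oplus> x = \<one>"
      using xc by algebra
    finally show False
      using left_ideal_eq_carrier I' by blast
  qed
  then have "\<one> \<in> L" by simp
  then obtain u where "u \<in> carrier R" "\<one> = u \<otimes> (\<one> \<ominus> x)"
    using xc unfolding L_def by auto
  then show ?thesis
    using that by simp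
qed

text \<open>If some \<open>x\<close> in \<open>K\<close> escapes a maximal left ideal
  \<open>I\<close>, then \<open>\<one> = i \<oplus> r \<otimes> x\<close> with \<open>i\<close> in
  \<open>I\<close>. The element \<open>z = r \<otimes> x\<close> of \<open>K\<close> is nilpotent,
  so \<open>\<one>\<close> is a left multiple of \<open>\<one> \<ominus> z = i\<close> and
  \<open>I\<close> is not proper.\<close>

lemma (in ring) nil_left_ideal_subset_jacobson_radical:
  assumes K: "left_ideal K R"
    and nil: "\<And>z. z \<in> K \<Longrightarrow> \<exists>N::nat. z [^] N = \<zero>"
  shows "K \<subseteq> jacobson_radical R"
proof -
  have "x \<in> I" if x: "x \<in> K" and I: "maximal_left_ideal I R" for x I
  proof (rule ccontr)
    assume "x \<notin> I"
    have xc: "x \<in> carrier R"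
      using x left_idealD(1)[OF K] by blast
    have I': "left_ideal I R" "I \<noteq> carrier R"
      and max: "\<And>L. left_ideal L R \<Longrightarrow> I \<subseteq> L \<Longrightarrow> L = I \<or> L = carrier R"
      using I unfolding maximal_left_ideal_def by auto
    note Ic = left_idealD[OF I'(1)]
    define L where "L = {i \<oplus> r \<otimes> x |i r. i \<in> I \<and> r \<in> carrier R}"
    have "left_ideal L R" "I \<subseteq> L" "x \<in> L"
      unfolding L_def by (rule left_ideal_add_principal[OF I'(1) xc])+
    then have "L = carrier R"
      using max \<open>x \<notin> I\<close> by blast
    then have "\<one> \<in> L" by simp
    then obtain i r where ir: "i \<in> I" "r \<in> carrier R" "\<one> = i \<oplus> r \<otimes> x"
      unfolding L_def by blast
    define z where "z = r \<otimes> x"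
    have z: "z \<in> K" "z \<in> carrier R"
      using left_idealD(4)[OF K ir(2) x] ir(2) xc by (auto simp: z_def)
    have "i \<in> carrier R" using ir(1) Ic(1) by blast
    then have "\<one> \<ominus> z = i"
      using z(2) ir(3) unfolding z_def[symmetric] by (simp add: a_minus_def a_assoc r_neg)
    \<comment> \<open>Telescoping: \<open>\<one> - z^(j+1)\<close> is the sum of
      \<open>\<one> - z^j\<close> and the left multiple \<open>z^j (\<one> - z)\<close> of
      \<open>i\<close>.\<close>
    have pow: "\<one> \<ominus> z [^] j \<in> I" for j :: nat
    proof (induction j)
      case 0
      then show ?case using Ic(2) by (simp add: a_minus_def r_neg)
    next
      case (Suc j)
      have zj: "z [^] j \<in> carrier R" using z(2) by simp
      have "z [^] j \<otimes> (\<one> \<ominus> z) \<in> I"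
        using Ic(4)[OF zj ir(1)] \<open>\<one> \<ominus> z = i\<close> by simp
      then have "(\<one> \<ominus> z [^] j) \<oplus> z [^] j \<otimes> (\<one> \<ominus> z) \<in> I"
        using Suc Ic(3) by blast
      also have "(\<one> \<ominus> z [^] j) \<oplus> z [^] j \<otimes> (\<one> \<ominus> z) = \<one> \<ominus> z [^] j \<otimes> z"
        using z(2) zj by (simp add: a_minus_def r_distr r_minus a_assoc[symmetric])
          (simp add: a_assoc l_neg)
      finally show ?case by simp
    qed
    obtain N :: nat where "z [^] N = \<zero>"
      using nil z(1) by blast
    then have "\<one> \<in> I"
      using pow[of N] by (simp add: a_minus_def)
    then show False
      using left_ideal_eq_carrier I' by blast
  qed
  then show ?thesis
    using left_idealD(1)[OF K] unfolding jacobson_radical_def by blast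
qed


section \<open>Algebras of finite monoids\<close>

text \<open>The value at \<open>f\<close> of the linear functional extending \<open>w\<close>.
  Elements of the algebra are compared through all these functionals, which replaces convolutions by
  iterated sums over the monoid.\<close>

definition pairing :: "('a, 'b) monoid_scheme \<Rightarrow> ('a \<Rightarrow> complex) \<Rightarrow> ('a \<Rightarrow> complex) \<Rightarrow> complex"
  where "pairing M f w = (\<Sum>a \<in> carrier M. f a * w a)"

text \<open>The linear extension of \<open>\<phi>\<close> to the monoid algebras.\<close>

definition push_forward :: "('a, 'b) monoid_scheme \<Rightarrow> ('a \<Rightarrow> 'c) \<Rightarrow> ('a \<Rightarrow> complex) \<Rightarrow> 'c \<Rightarrow> complex"
  where "push_forward M \<phi> f y = (\<Sum>a \<in> {a \<in> carrier M. \<phi> a = y}. f a)"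

lemma smult_monoid_algebra [simp]: "c \<odot>\<^bsub>monoid_algebra M\<^esub> f = (\<lambda>x. c * f x)"
  and add_monoid_algebra [simp]: "f \<oplus>\<^bsub>monoid_algebra M\<^esub> g = (\<lambda>x. f x + g x)"
  and zero_monoid_algebra [simp]: "\<zero>\<^bsub>monoid_algebra M\<^esub> = (\<lambda>x. 0)"
  by (simp_all add: monoid_algebra_def)

lemma pairing_cong:
  "(\<And>a. a \<in> carrier M \<Longrightarrow> v a = w a) \<Longrightarrow> pairing M f v = pairing M f w"
  unfolding pairing_def by (rule sum.cong) auto

lemma pairing_add: "pairing M (\<lambda>x. f x + g x) w = pairing M f w + pairing M g w"
  and pairing_add_right: "pairing M f (\<lambda>x. v x + w x) = pairing M f v + pairing M f w"
  and pairing_scale: "pairing M (\<lambda>x. c * f x) w = c * pairing M f w"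
  and pairing_zero: "pairing M (\<lambda>x. 0) w = 0"
  by (simp_all add: pairing_def sum.distrib sum_distrib_left algebra_simps)

locale finite_monoid = monoid M for M (structure) +
  assumes finite_carrier [simp]: "finite (carrier M)"
begin

abbreviation alg where "alg \<equiv> monoid_algebra M"

lemma monoid_algebra_carrier: "f \<in> carrier alg \<longleftrightarrow> (\<forall>x. f x \<noteq> 0 \<longrightarrow> x \<in> carrier M)"
  using finite_subset[OF _ finite_carrier, of "{x. f x \<noteq> 0}"]
  by (auto simp: monoid_algebra_def)

text \<open>Indicator functions of points recover the coefficients.\<close>

lemma monoid_algebra_eqI:
  assumes "f \<in> carrier alg" "g \<in> carrier alg" "\<And>w. pairing M f w = pairing M g w"
  shows "f = g"
proof
  fix x
  have *: "pairing M h (\<lambda>a. if a = x then 1 else 0) = (if x \<in> carrier M then h x else 0)" for h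
    unfolding pairing_def by (simp add: if_distrib cong: if_cong)
  show "f x = g x"
    using assms(3)[of "\<lambda>a. if a = x then 1 else 0"] assms(1,2)
    unfolding * monoid_algebra_carrier by (metis (full_types))
qed

lemma mult_monoid_algebra:
  assumes "f \<in> carrier alg" "g \<in> carrier alg"
  shows "(f \<otimes>\<^bsub>alg\<^esub> g) x = (\<Sum>a \<in> carrier M. \<Sum>b \<in> carrier M. if a \<otimes> b = x then f a * g b else 0)"
proof -
  have "(f \<otimes>\<^bsub>alg\<^esub> g) x = (\<Sum>(a, b) \<in> {(a, b). f a \<noteq> 0 \<and> g b \<noteq> 0 \<and> a \<otimes> b = x}. f a * g b)"
    by (simp add: monoid_algebra_def)
  also have "\<dots> = (\<Sum>(a, b) \<in> carrier M \<times> carrier M. if a \<otimes> b = x then f a * g b else 0)"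
    using assms unfolding monoid_algebra_carrier
    by (intro sum.mono_neutral_cong_left) (auto split: if_splits)
  finally show ?thesis
    by (simp add: sum.cartesian_product)
qed

lemma mult_closed_monoid_algebra:
  assumes "f \<in> carrier alg" "g \<in> carrier alg"
  shows "f \<otimes>\<^bsub>alg\<^esub> g \<in> carrier alg"
proof -
  have "x \<in> carrier M" if "(f \<otimes>\<^bsub>alg\<^esub> g) x \<noteq> 0" for x
  proof (rule ccontr)
    assume "x \<notin> carrier M"
    then have "(f \<otimes>\<^bsub>alg\<^esub> g) x = 0"
      unfolding mult_monoid_algebra[OF assms] by (intro sum.neutral ballI) auto
    then show False using that by simp
  qed
  then show ?thesis
    unfolding monoid_algebra_carrier by blast
qed

text \<open>Summing first over the value \<open>x\<close> of the product removes the convolution;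
  the laws of the algebra then reduce to laws of \<open>\<otimes>\<close> inside the test
  function.\<close>

lemma pairing_mult:
  assumes "f \<in> carrier alg" "g \<in> carrier alg"
  shows "pairing M (f \<otimes>\<^bsub>alg\<^esub> g) w = pairing M f (\<lambda>a. pairing M g (\<lambda>b. w (a \<otimes> b)))"
proof -
  have "pairing M (f \<otimes>\<^bsub>alg\<^esub> g) w =
      (\<Sum>x \<in> carrier M. \<Sum>a \<in> carrier M. \<Sum>b \<in> carrier M. if a \<otimes> b = x then f a * g b * w x else 0)"
    unfolding pairing_def mult_monoid_algebra[OF assms]
    by (simp add: sum_distrib_right if_distrib[of "\<lambda>u. u * _"] cong: if_cong)
  also have "\<dots> = (\<Sum>a \<in> carrier M. \<Sum>b \<in> carrier M. \<Sum>x \<in> carrier M. if a \<otimes> b = x then f a * g b * w x else 0)"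
    by (subst sum.swap, rule sum.cong[OF refl], rule sum.swap)
  also have "\<dots> = (\<Sum>a \<in> carrier M. \<Sum>b \<in> carrier M. f a * g b * w (a \<otimes> b))"
    by (intro sum.cong refl) simp
  also have "\<dots> = pairing M f (\<lambda>a. pairing M g (\<lambda>b. w (a \<otimes> b)))"
    by (simp add: pairing_def sum_distrib_left mult.assoc)
  finally show ?thesis .
qed

lemma one_monoid_algebra: "\<one>\<^bsub>alg\<^esub> = (\<lambda>x. if x = \<one> then 1 else 0)"
  by (simp add: monoid_algebra_def)

lemma pairing_one: "pairing M \<one>\<^bsub>alg\<^esub> w = w \<one>"
  unfolding pairing_def one_monoid_algebra by (simp add: if_distrib[of "\<lambda>u. u * _"] cong: if_cong)

lemma ring_monoid_algebra: "ring alg"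
proof (rule ringI)
  show "abelian_group alg"
  proof (rule abelian_groupI)
    fix f assume "f \<in> carrier alg"
    then show "\<exists>g\<in>carrier alg. g \<oplus>\<^bsub>alg\<^esub> f = \<zero>\<^bsub>alg\<^esub>"
      by (intro bexI[of _ "\<lambda>x. - f x"]) (auto simp: monoid_algebra_carrier)
  next
    fix f g assume *: "f \<in> carrier alg" "g \<in> carrier alg"
    have "x \<in> carrier M" if "f x + g x \<noteq> 0" for x
      using * that unfolding monoid_algebra_carrier by (cases "f x = 0") auto
    then show "f \<oplus>\<^bsub>alg\<^esub> g \<in> carrier alg"
      unfolding monoid_algebra_carrier by simp
  qed (auto simp: monoid_algebra_carrier ac_simps)
  show "monoid alg"
  proof (rule monoidI)
    show one: "\<one>\<^bsub>alg\<^esub> \<in> carrier alg"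
      unfolding monoid_algebra_carrier one_monoid_algebra by simp
    show "\<one>\<^bsub>alg\<^esub> \<otimes>\<^bsub>alg\<^esub> f = f" "f \<otimes>\<^bsub>alg\<^esub> \<one>\<^bsub>alg\<^esub> = f" if f: "f \<in> carrier alg" for f
      by (intro monoid_algebra_eqI mult_closed_monoid_algebra one f;
          simp add: pairing_mult one f pairing_one cong: pairing_cong)+
    fix f g h assume *: "f \<in> carrier alg" "g \<in> carrier alg" "h \<in> carrier alg"
    show "f \<otimes>\<^bsub>alg\<^esub> g \<otimes>\<^bsub>alg\<^esub> h = f \<otimes>\<^bsub>alg\<^esub> (g \<otimes>\<^bsub>alg\<^esub> h)"
      by (intro monoid_algebra_eqI mult_closed_monoid_algebra *)
        (simp add: pairing_mult mult_closed_monoid_algebra * m_assoc cong: pairing_cong)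
  qed (rule mult_closed_monoid_algebra)
  fix f g h assume *: "f \<in> carrier alg" "g \<in> carrier alg" "h \<in> carrier alg"
  have add: "(\<lambda>x. u x + v x) \<in> carrier alg" if "u \<in> carrier alg" "v \<in> carrier alg" for u v
    using abelian_groupE(1)[OF \<open>abelian_group alg\<close> that] by simp
  show "(f \<oplus>\<^bsub>alg\<^esub> g) \<otimes>\<^bsub>alg\<^esub> h = f \<otimes>\<^bsub>alg\<^esub> h \<oplus>\<^bsub>alg\<^esub> g \<otimes>\<^bsub>alg\<^esub> h"
    "h \<otimes>\<^bsub>alg\<^esub> (f \<oplus>\<^bsub>alg\<^esub> g) = h \<otimes>\<^bsub>alg\<^esub> f \<oplus>\<^bsub>alg\<^esub> h \<otimes>\<^bsub>alg\<^esub> g"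
    unfolding add_monoid_algebra
    by (intro monoid_algebra_eqI mult_closed_monoid_algebra add *;
        simp add: pairing_mult pairing_add pairing_add_right mult_closed_monoid_algebra add *)+
qed

sublocale alg: ring alg
  by (rule ring_monoid_algebra)

lemma smult_closed_monoid_algebra:
  "f \<in> carrier alg \<Longrightarrow> (\<lambda>x. c * f x) \<in> carrier alg"
  unfolding monoid_algebra_carrier by simp

section \<open>Linear extensions of homomorphisms\<close>

text \<open>Grouping the sum by the fibres of \<open>\<phi>\<close> shows that pushing coefficients
  forward is adjoint to pulling test functions back.\<close>

lemma pairing_push_forward:
  assumes "finite_monoid N" "\<phi> \<in> carrier M \<rightarrow> carrier N"
  shows "pairing N (push_forward M \<phi> f) w = pairing M f (\<lambda>a. w (\<phi> a))"
proof -
  interpret N: finite_monoid N by fact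
  have "pairing N (push_forward M \<phi> f) w = (\<Sum>y \<in> carrier N. \<Sum>a \<in> {a \<in> carrier M. \<phi> a = y}. f a * w (\<phi> a))"
    unfolding pairing_def push_forward_def by (simp add: sum_distrib_right)
  also have "\<dots> = pairing M f (\<lambda>a. w (\<phi> a))"
    unfolding pairing_def by (rule sum.group) (use assms in auto)
  finally show ?thesis .
qed

lemma push_forward_closed:
  assumes "finite_monoid N" "\<phi> \<in> carrier M \<rightarrow> carrier N"
  shows "push_forward M \<phi> f \<in> carrier (monoid_algebra N)"
proof -
  interpret N: finite_monoid N by fact
  have "{a \<in> carrier M. \<phi> a = y} = {}" if "y \<notin> carrier N" for y
    using that assms(2) by auto
  then have "push_forward M \<phi> f y = 0" if "y \<notin> carrier N" for y
    unfolding push_forward_def using that by (metis sum.empty)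
  then show ?thesis
    unfolding N.monoid_algebra_carrier by blast
qed

lemma push_forward_ring_hom:
  assumes N: "finite_monoid N" and \<phi>: "\<phi> \<in> hom M N" "\<phi> \<one> = \<one>\<^bsub>N\<^esub>"
  shows "push_forward M \<phi> \<in> ring_hom alg (monoid_algebra N)"
proof -
  interpret N: finite_monoid N by fact
  have \<phi>': "\<phi> \<in> carrier M \<rightarrow> carrier N"
    using \<phi>(1) unfolding hom_def by auto
  note push = pairing_push_forward[OF N \<phi>'] push_forward_closed[OF N \<phi>']
  show ?thesis
  proof (rule ring_hom_memI)
    fix f g assume *: "f \<in> carrier alg" "g \<in> carrier alg"
    show "push_forward M \<phi> (f \<otimes>\<^bsub>alg\<^esub> g) =
        push_forward M \<phi> f \<otimes>\<^bsub>monoid_algebra N\<^esub> push_forward M \<phi> g"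
      by (intro N.monoid_algebra_eqI push N.mult_closed_monoid_algebra)
        (simp add: N.pairing_mult pairing_mult push * hom_mult[OF \<phi>(1)] cong: pairing_cong)
    show "push_forward M \<phi> (f \<oplus>\<^bsub>alg\<^esub> g) =
        push_forward M \<phi> f \<oplus>\<^bsub>monoid_algebra N\<^esub> push_forward M \<phi> g"
      by (simp add: push_forward_def sum.distrib fun_eq_iff)
  next
    show "push_forward M \<phi> \<one>\<^bsub>alg\<^esub> = \<one>\<^bsub>monoid_algebra N\<^esub>"
      by (intro N.monoid_algebra_eqI push) (simp_all add: push pairing_one N.pairing_one \<phi>)
  qed (rule push)
qed

lemma push_forward_scale: "push_forward M \<phi> (\<lambda>x. c * f x) = (\<lambda>y. c * push_forward M \<phi> f y)"
  by (simp add: push_forward_def sum_distrib_left fun_eq_iff)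

lemma push_forward_surj:
  assumes N: "finite_monoid N" and \<phi>: "\<phi> ` carrier M = carrier N"
  shows "push_forward M \<phi> ` carrier alg = carrier (monoid_algebra N)"
proof
  interpret N: finite_monoid N by fact
  show "push_forward M \<phi> ` carrier alg \<subseteq> carrier (monoid_algebra N)"
    using push_forward_closed[OF N] \<phi> by blast
  show "carrier (monoid_algebra N) \<subseteq> push_forward M \<phi> ` carrier alg"
  proof
    fix h assume h: "h \<in> carrier (monoid_algebra N)"
    \<comment> \<open>A section of \<open>\<phi>\<close>: placing the coefficient \<open>h y\<close>
      at the single point \<open>s y\<close> of each fibre gives a preimage of
      \<open>h\<close>.\<close>
    define s where "s = inv_into (carrier M) \<phi>"
    have s: "s y \<in> carrier M" "\<phi> (s y) = y" if "y \<in> carrier N" for y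
      using that \<phi> unfolding s_def by (auto intro: inv_into_into f_inv_into_f)
    define f where "f a = (if a \<in> carrier M \<and> a = s (\<phi> a) then h (\<phi> a) else 0)" for a
    have "push_forward M \<phi> f y = h y" for y
    proof (cases "y \<in> carrier N")
      case True
      have "push_forward M \<phi> f y = (\<Sum>a \<in> {s y}. h y)"
        unfolding push_forward_def
        by (rule sum.mono_neutral_cong_right) (use True s in \<open>auto simp: f_def\<close>)
      then show ?thesis by simp
    next
      case False
      then have "push_forward M \<phi> f y = 0" "h y = 0"
        using h push_forward_closed[OF N, of \<phi> f] \<phi> unfolding N.monoid_algebra_carrier by blast+
      then show ?thesis by simp
    qed
    moreover have "f \<in> carrier alg"
      unfolding monoid_algebra_carrier f_def by auto
    ultimately show "h \<in> push_forward M \<phi> ` carrier alg"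
      by (intro image_eqI[of _ _ f]) auto
  qed
qed

end

section \<open>Descending chains and nilpotence of the radical\<close>

text \<open>The functions supported in \<open>S\<close> form a finite-dimensional space; the proof
  eliminates one coordinate at a time.\<close>

lemma descending_subspaces_stabilise:
  fixes V :: "nat \<Rightarrow> ('a \<Rightarrow> complex) set"
  assumes "finite S"
    and "\<And>k. V (Suc k) \<subseteq> V k"
    and "\<And>k. (\<lambda>x. 0) \<in> V k"
    and "\<And>k u v c. u \<in> V k \<Longrightarrow> v \<in> V k \<Longrightarrow> (\<lambda>x. u x + c * v x) \<in> V k"
    and "\<And>k v x. v \<in> V k \<Longrightarrow> v x \<noteq> 0 \<Longrightarrow> x \<in> S"
  shows "\<exists>K. \<forall>k \<ge> K. V k = V K"
  using assms
proof (induction S arbitrary: V rule: finite_induct)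
  case empty
  have "V k = {\<lambda>x. 0}" for k
    using empty.prems(2)[of k] empty.prems(4)[of _ k] by fast
  then show ?case by simp
next
  case (insert s S)
  have anti: "V k \<subseteq> V j" if "j \<le> k" for j k
    using lift_Suc_antimono_le[of V, OF insert.prems(1) that] .
  \<comment> \<open>The members vanishing at \<open>s\<close> are supported in \<open>S\<close>, so
    the induction hypothesis applies to them.\<close>
  define W where "W k = {v \<in> V k. v s = 0}" for k
  have "\<exists>K. \<forall>k \<ge> K. W k = W K"
  proof (rule insert.IH)
    show "W (Suc k) \<subseteq> W k" "(\<lambda>x. 0) \<in> W k" for k
      using insert.prems(1,2) unfolding W_def by auto
    show "(\<lambda>x. u x + c * v x) \<in> W k" if "u \<in> W k" "v \<in> W k" for k u v c
      using that insert.prems(3) unfolding W_def by auto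
    show "x \<in> S" if "v \<in> W k" "v x \<noteq> 0" for k v x
      using that insert.prems(4)[of v k x] unfolding W_def by auto
  qed
  then obtain K where K: "\<And>k. k \<ge> K \<Longrightarrow> W k = W K"
    by blast
  show ?case
  proof (cases "\<exists>L. V L = W L")
    case True
    then obtain L where L: "V L = W L" by blast
    have "V k = W k" if "k \<ge> L" for k
      using anti[OF that] L unfolding W_def by blast
    then have "V k = V (max K L)" if "k \<ge> max K L" for k
      using that K[of k] K[of "max K L"] by simp
    then show ?thesis by blast
  next
    case False
    \<comment> \<open>Here every \<open>V k\<close> has a member \<open>u\<close> with
      \<open>u s \<noteq> 0\<close>. Subtracting a multiple of it moves \<open>v\<close> into
      \<open>W K = W k\<close>, and adding the multiple back stays in \<open>V k\<close>.\<close>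
    have "V K \<subseteq> V k" if "k \<ge> K" for k
    proof
      fix v assume v: "v \<in> V K"
      obtain u where u: "u \<in> V k" "u s \<noteq> 0"
        using False unfolding W_def by blast
      have "(\<lambda>x. v x + (- v s / u s) * u x) \<in> V K"
        using insert.prems(3) v u anti[OF that] by blast
      then have "(\<lambda>x. v x + (- v s / u s) * u x) \<in> W k"
        unfolding K[OF that] using u(2) unfolding W_def by simp
      then have "(\<lambda>x. (v x + (- v s / u s) * u x) + (v s / u s) * u x) \<in> V k"
        using insert.prems(3) u(1) unfolding W_def by blast
      then show "v \<in> V k" by simp
    qed
    then show ?thesis
      using anti by blast
  qed
qed

context finite_monoid
begin

text \<open>
  The descending chain of the left ideals generated by the powers of \<open>h\<close> gives
  \<open>h\<^sup>K = a h h\<^sup>K\<close> for some \<open>K\<close> and \<open>a\<close>, and \<open>1 - a h\<close> is left invertible.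
\<close>
lemma jacobson_radical_nilpotent:
  assumes h: "h \<in> jacobson_radical alg"
  shows "\<exists>K::nat. h [^]\<^bsub>alg\<^esub> K = \<zero>\<^bsub>alg\<^esub>"
proof -
  have hc: "h \<in> carrier alg"
    using h by (simp add: jacobson_radical_def)
  define V where "V k = (\<lambda>a. a \<otimes>\<^bsub>alg\<^esub> h [^]\<^bsub>alg\<^esub> k) ` carrier alg" for k :: nat
  have "\<exists>K. \<forall>k \<ge> K. V k = V K"
  proof (rule descending_subspaces_stabilise[OF finite_carrier])
    show "V (Suc k) \<subseteq> V k" for k
    proof
      fix v assume "v \<in> V (Suc k)"
      then obtain a where a: "a \<in> carrier alg" "v = a \<otimes>\<^bsub>alg\<^esub> h [^]\<^bsub>alg\<^esub> Suc k"
        unfolding V_def by blast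
      then have "v = (a \<otimes>\<^bsub>alg\<^esub> h) \<otimes>\<^bsub>alg\<^esub> h [^]\<^bsub>alg\<^esub> k"
        using hc by (metis alg.m_assoc alg.nat_pow_Suc2 alg.nat_pow_closed)
      then show "v \<in> V k"
        using a hc unfolding V_def by blast
    qed
    show "(\<lambda>x. 0) \<in> V k" for k
      unfolding V_def by (rule image_eqI[of _ _ "\<zero>\<^bsub>alg\<^esub>"]) (use hc alg.l_null alg.zero_closed in auto)
    show "x \<in> carrier M" if "v \<in> V k" "v x \<noteq> 0" for v k x
    proof -
      have "v \<in> carrier alg"
        using that(1) hc unfolding V_def by auto
      then show ?thesis
        using that(2) unfolding monoid_algebra_carrier by blast
    qed
    show "(\<lambda>x. u x + c * v x) \<in> V k" if uv: "u \<in> V k" "v \<in> V k" for u v k c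
    proof -
      obtain a b where ab: "a \<in> carrier alg" "b \<in> carrier alg"
        "u = a \<otimes>\<^bsub>alg\<^esub> h [^]\<^bsub>alg\<^esub> k" "v = b \<otimes>\<^bsub>alg\<^esub> h [^]\<^bsub>alg\<^esub> k"
        using uv unfolding V_def by blast
      have cb: "(\<lambda>x. c * b x) \<in> carrier alg"
        using ab smult_closed_monoid_algebra by blast
      have hk: "h [^]\<^bsub>alg\<^esub> k \<in> carrier alg"
        using hc by simp
      have "(\<lambda>x. c * v x) = (\<lambda>x. c * b x) \<otimes>\<^bsub>alg\<^esub> h [^]\<^bsub>alg\<^esub> k"
        unfolding ab(4)
        by (intro monoid_algebra_eqI mult_closed_monoid_algebra smult_closed_monoid_algebra ab hk)
          (simp add: pairing_mult pairing_scale ab cb hk)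
      moreover have "(\<lambda>x. u x + c * v x) = u \<oplus>\<^bsub>alg\<^esub> (\<lambda>x. c * v x)"
        by simp
      ultimately have "(\<lambda>x. u x + c * v x) = (a \<oplus>\<^bsub>alg\<^esub> (\<lambda>x. c * b x)) \<otimes>\<^bsub>alg\<^esub> h [^]\<^bsub>alg\<^esub> k"
        using alg.l_distr[OF ab(1) cb hk] ab(3) by simp
      then show ?thesis
        unfolding V_def using alg.a_closed[OF ab(1) cb] by blast
    qed
  qed
  then obtain K where K: "\<And>k. k \<ge> K \<Longrightarrow> V k = V K"
    by blast
  have "V K = V (Suc K)"
    using K[of "Suc K"] by simp
  moreover have hK: "h [^]\<^bsub>alg\<^esub> K \<in> carrier alg"
    using hc by simp
  then have "h [^]\<^bsub>alg\<^esub> K \<in> V K"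
    unfolding V_def by (intro image_eqI[of _ _ "\<one>\<^bsub>alg\<^esub>"]) auto
  ultimately obtain a where a: "a \<in> carrier alg" "h [^]\<^bsub>alg\<^esub> K = a \<otimes>\<^bsub>alg\<^esub> h [^]\<^bsub>alg\<^esub> Suc K"
    unfolding V_def by auto
  define z where "z = a \<otimes>\<^bsub>alg\<^esub> h"
  have z: "z \<in> carrier alg" "z \<in> jacobson_radical alg"
    using a hc h alg.jacobson_radical_mult_left by (auto simp: z_def)
  have "h [^]\<^bsub>alg\<^esub> K = z \<otimes>\<^bsub>alg\<^esub> h [^]\<^bsub>alg\<^esub> K"
    unfolding z_def using a hc by (metis alg.m_assoc alg.nat_pow_Suc2 alg.nat_pow_closed)
  then have eq: "(\<one>\<^bsub>alg\<^esub> \<ominus>\<^bsub>alg\<^esub> z) \<otimes>\<^bsub>alg\<^esub> h [^]\<^bsub>alg\<^esub> K = \<zero>\<^bsub>alg\<^esub>"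
    using z(1) hK
    by (metis a_minus_def alg.a_inv_closed alg.l_distr alg.l_minus alg.l_one alg.one_closed alg.r_neg)
  obtain u where u: "u \<in> carrier alg" "u \<otimes>\<^bsub>alg\<^esub> (\<one>\<^bsub>alg\<^esub> \<ominus>\<^bsub>alg\<^esub> z) = \<one>\<^bsub>alg\<^esub>"
    using alg.jacobson_radical_left_inverse[OF z(2)] by blast
  have "h [^]\<^bsub>alg\<^esub> K = u \<otimes>\<^bsub>alg\<^esub> (\<one>\<^bsub>alg\<^esub> \<ominus>\<^bsub>alg\<^esub> z) \<otimes>\<^bsub>alg\<^esub> h [^]\<^bsub>alg\<^esub> K"
    using u hK by simp
  also have "\<dots> = u \<otimes>\<^bsub>alg\<^esub> ((\<one>\<^bsub>alg\<^esub> \<ominus>\<^bsub>alg\<^esub> z) \<otimes>\<^bsub>alg\<^esub> h [^]\<^bsub>alg\<^esub> K)"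
    using u hK z(1) by (intro alg.m_assoc) auto
  also have "\<dots> = \<zero>\<^bsub>alg\<^esub>"
    unfolding eq using u(1) by (rule alg.r_null)
  finally show ?thesis by blast
qed

text \<open>Let the matrix of \<open>y\<close> be the conjugate transpose of the matrix of
  \<open>x\<close>. Then \<open>h = y x\<close> is in the radical, hence nilpotent, and its matrix
  is Hermitian, hence zero; this forces the matrix of \<open>x\<close> to vanish.\<close>

lemma jacobson_radical_matrix_rep:
  fixes E :: "'a \<Rightarrow> 'i \<Rightarrow> 'i \<Rightarrow> complex"
  assumes I: "finite I"
    and mult: "\<And>a b i j. a \<in> carrier M \<Longrightarrow> b \<in> carrier M \<Longrightarrow> i \<in> I \<Longrightarrow> j \<in> I \<Longrightarrow>
      E (a \<otimes> b) i j = (\<Sum>k \<in> I. E a i k * E b k j)"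
    and adj: "\<And>a. a \<in> carrier M \<Longrightarrow> \<exists>b \<in> carrier M. \<forall>i \<in> I. \<forall>j \<in> I. E b i j = cnj (E a j i)"
    and x: "x \<in> jacobson_radical alg" and ij: "i \<in> I" "j \<in> I"
  shows "pairing M x (\<lambda>a. E a i j) = 0"
proof -
  define R where "R f i j = pairing M f (\<lambda>a. E a i j)" for f i j
  have R_mult: "R (f \<otimes>\<^bsub>alg\<^esub> g) i j = (\<Sum>k \<in> I. R f i k * R g k j)"
    if "f \<in> carrier alg" "g \<in> carrier alg" "i \<in> I" "j \<in> I" for f g i j
  proof -
    have "R (f \<otimes>\<^bsub>alg\<^esub> g) i j =
        (\<Sum>a \<in> carrier M. f a * (\<Sum>b \<in> carrier M. g b * (\<Sum>k \<in> I. E a i k * E b k j)))"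
      unfolding R_def using that by (simp add: pairing_mult) (simp add: pairing_def mult)
    also have "\<dots> = (\<Sum>a \<in> carrier M. \<Sum>k \<in> I. \<Sum>b \<in> carrier M. f a * E a i k * (g b * E b k j))"
      unfolding sum_distrib_left by (subst (2) sum.swap) (simp add: mult_ac)
    also have "\<dots> = (\<Sum>k \<in> I. \<Sum>a \<in> carrier M. \<Sum>b \<in> carrier M. f a * E a i k * (g b * E b k j))"
      by (rule sum.swap)
    finally show ?thesis
      unfolding R_def pairing_def by (simp add: sum_product)
  qed
  \<comment> \<open>As \<open>R f\<close> is the adjoint of \<open>R g\<close>, the diagonal entry
    is the squared norm of the \<open>i\<close>-th column of \<open>R g\<close>.\<close>
  have positive: "R g k i = 0"
    if "f \<in> carrier alg" "g \<in> carrier alg" "R (f \<otimes>\<^bsub>alg\<^esub> g) i i = 0" "i \<in> I" "k \<in> I"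
      and fg: "\<And>i j. i \<in> I \<Longrightarrow> j \<in> I \<Longrightarrow> R f i j = cnj (R g j i)" for f g i k
  proof -
    have "0 = (\<Sum>k \<in> I. cnj (R g k i) * R g k i)"
      using that R_mult[of f g i i] fg by simp
    also have "\<dots> = complex_of_real (\<Sum>k \<in> I. (cmod (R g k i))\<^sup>2)"
      by (simp add: complex_norm_square mult.commute del: of_real_power)
    finally have "(\<Sum>k \<in> I. (cmod (R g k i))\<^sup>2) = 0"
      by (metis of_real_eq_0_iff)
    then show ?thesis
      using I \<open>k \<in> I\<close> by (simp add: sum_nonneg_eq_0_iff)
  qed
  have xc: "x \<in> carrier alg"
    using x by (simp add: jacobson_radical_def)
  obtain s where s: "\<And>a. a \<in> carrier M \<Longrightarrow> s a \<in> carrier M"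
    "\<And>a i j. a \<in> carrier M \<Longrightarrow> i \<in> I \<Longrightarrow> j \<in> I \<Longrightarrow> E (s a) i j = cnj (E a j i)"
    using adj by metis
  \<comment> \<open>\<open>s\<close> merely selects for each \<open>a\<close> an element with the
    adjoint matrix; conjugating the coefficients then makes \<open>R y\<close> the adjoint of
    \<open>R x\<close>.\<close>
  define y where "y = push_forward M s (\<lambda>a. cnj (x a))"
  have y: "y \<in> carrier alg" "\<And>i j. i \<in> I \<Longrightarrow> j \<in> I \<Longrightarrow> R y i j = cnj (R x j i)"
  proof -
    have "s \<in> carrier M \<rightarrow> carrier M"
      using s(1) by blast
    note push = push_forward_closed[OF finite_monoid_axioms this]
      pairing_push_forward[OF finite_monoid_axioms this]
    show "y \<in> carrier alg"
      unfolding y_def by (rule push)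
    show "R y i j = cnj (R x j i)" if "i \<in> I" "j \<in> I" for i j
      unfolding y_def R_def push by (simp add: pairing_def s that)
  qed
  define h where "h = y \<otimes>\<^bsub>alg\<^esub> x"
  have h: "h \<in> carrier alg" "h \<in> jacobson_radical alg"
    using xc y(1) x alg.jacobson_radical_mult_left by (auto simp: h_def)
  have h1: "R h i j = cnj (R h j i)" if "i \<in> I" "j \<in> I" for i j
    unfolding h_def using that xc y by (simp add: R_mult mult.commute)
  have herm: "R (h [^]\<^bsub>alg\<^esub> Suc k) i j = cnj (R (h [^]\<^bsub>alg\<^esub> Suc k) j i)"
    if "i \<in> I" "j \<in> I" for i j and k :: nat
    using that
  proof (induction k arbitrary: i j)
    case 0
    then show ?case using h h1[of i j] by simp
  next
    case (Suc k)
    have hk: "h [^]\<^bsub>alg\<^esub> Suc k \<in> carrier alg"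
      using h(1) by (rule alg.nat_pow_closed)
    have "R (h [^]\<^bsub>alg\<^esub> Suc (Suc k)) i j = (\<Sum>l \<in> I. R (h [^]\<^bsub>alg\<^esub> Suc k) i l * R h l j)"
      by (subst alg.nat_pow_Suc, rule R_mult[OF hk h(1) Suc.prems])
    also have "\<dots> = (\<Sum>l \<in> I. cnj (R h j l * R (h [^]\<^bsub>alg\<^esub> Suc k) l i))"
    proof (rule sum.cong[OF refl])
      fix l assume l: "l \<in> I"
      show "R (h [^]\<^bsub>alg\<^esub> Suc k) i l * R h l j = cnj (R h j l * R (h [^]\<^bsub>alg\<^esub> Suc k) l i)"
        unfolding Suc.IH[OF Suc.prems(1) l] h1[OF l Suc.prems(2)]
        by (simp add: mult.commute del: alg.nat_pow_Suc)
    qed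
    also have "\<dots> = cnj (R (h \<otimes>\<^bsub>alg\<^esub> h [^]\<^bsub>alg\<^esub> Suc k) j i)"
      by (subst R_mult[OF h(1) hk Suc.prems(2,1)]) simp
    also have "h \<otimes>\<^bsub>alg\<^esub> h [^]\<^bsub>alg\<^esub> Suc k = h [^]\<^bsub>alg\<^esub> Suc (Suc k)"
      by (rule alg.nat_pow_Suc2[OF h(1), symmetric])
    finally show ?case .
  qed
  \<comment> \<open>Write \<open>H_k\<close> for the matrix of \<open>h^k\<close>. If
    \<open>H_(k+2)\<close> is zero, then so is the square of \<open>H_(k+1)\<close>, being
    \<open>H_(k+2)\<close> times \<open>H_k\<close>, and positivity gives
    \<open>H_(k+1) = 0\<close>. Exponents start at \<open>1\<close>, where the power is
    \<open>h\<close> itself.\<close>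
  have descend: "\<forall>i \<in> I. \<forall>j \<in> I. R h i j = 0"
    if "\<And>i j. i \<in> I \<Longrightarrow> j \<in> I \<Longrightarrow> R (h [^]\<^bsub>alg\<^esub> Suc k) i j = 0" for k :: nat
    using that
  proof (induction k)
    case 0
    then show ?case using h by simp
  next
    case (Suc k)
    have hk: "h [^]\<^bsub>alg\<^esub> m \<in> carrier alg" for m :: nat
      using h(1) by (rule alg.nat_pow_closed)
    show ?case
    proof (rule Suc.IH, rule positive[OF hk hk _ _ _ herm])
      fix i j assume "i \<in> I" "j \<in> I"
      have "h [^]\<^bsub>alg\<^esub> Suc k \<otimes>\<^bsub>alg\<^esub> h [^]\<^bsub>alg\<^esub> Suc k = h [^]\<^bsub>alg\<^esub> Suc (Suc k) \<otimes>\<^bsub>alg\<^esub> h [^]\<^bsub>alg\<^esub> k"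
        by (simp only: alg.nat_pow_mult[OF h(1)]) simp
      then show "R (h [^]\<^bsub>alg\<^esub> Suc k \<otimes>\<^bsub>alg\<^esub> h [^]\<^bsub>alg\<^esub> Suc k) j j = 0"
        using R_mult[OF hk hk \<open>j \<in> I\<close> \<open>j \<in> I\<close>, of "Suc (Suc k)" k] Suc.prems[OF \<open>j \<in> I\<close>]
        by (simp del: alg.nat_pow_Suc)
    qed
  qed
  obtain K :: nat where "h [^]\<^bsub>alg\<^esub> K = \<zero>\<^bsub>alg\<^esub>"
    using jacobson_radical_nilpotent[OF h(2)] by blast
  then have "h [^]\<^bsub>alg\<^esub> Suc K = (\<lambda>x. 0)"
    using alg.l_null[OF h(1)] by simp
  then have "R (h [^]\<^bsub>alg\<^esub> Suc K) i j = 0" for i j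
    unfolding R_def by (simp only: pairing_zero)
  then have "R h j j = 0"
    using descend ij by blast
  then show ?thesis
    using positive[OF y(1) xc _ ij(2,1) y(2)] unfolding h_def R_def by blast
qed

end


section \<open>Unions of permutation graphs\<close>

text \<open>For \<open>n > 0\<close> these are, as 0-1 matrices, the nonzero ones with total
  support: every entry 1 belongs to a permutation matrix lying below.\<close>

definition hall_relations :: "nat \<Rightarrow> (nat \<times> nat) set set"
  where "hall_relations n =
    {\<Union>a \<in> A. perm_rel n a |A. A \<subseteq> carrier (sym_group n) \<and> A \<noteq> {}}"

text \<open>The union over all representatives avoids a choice; for a class in \<open>FP n\<close>,
  each of them alone gives the same relation.\<close>

definition class_rel :: "nat \<Rightarrow> (nat \<Rightarrow> nat) set set \<Rightarrow> (nat \<times> nat) set"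
  where "class_rel n X = (\<Union>A \<in> X. \<Union>a \<in> A. perm_rel n a)"

section \<open>Classes of sets of permutations as relations\<close>

lemma mem_perm_rel: "(m, k) \<in> perm_rel n a \<longleftrightarrow> m \<in> {1..n} \<and> k = a m"
  by (auto simp: perm_rel_def)

lemma perm_rel_comp:
  assumes "\<tau> permutes {1..n}"
  shows "perm_rel n (\<sigma> \<circ> \<tau>) = perm_rel n \<sigma> \<cdot>\<^sub>r perm_rel n \<tau>"
  using permutes_in_image[OF assms] unfolding rel_prod_def perm_rel_def by fastforce

text \<open>The set of values at \<open>m\<close> is the fibre over \<open>m\<close> of the union of
  graphs, and a relation is determined by its fibres.\<close>

lemma FP_rel_iff:
  "(A, B) \<in> FP_rel n \<longleftrightarrow> A \<subseteq> carrier (sym_group n) \<and> A \<noteq> {} \<and>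
    B \<subseteq> carrier (sym_group n) \<and> B \<noteq> {} \<and> (\<Union>a \<in> A. perm_rel n a) = (\<Union>b \<in> B. perm_rel n b)"
proof -
  have union: "(\<Union>c \<in> C. perm_rel n c) = (SIGMA m:{1..n}. {c m |c. c \<in> C})" for C
    by (auto simp: perm_rel_def)
  have "(\<forall>m \<in> {1..n}. {a m |a. a \<in> A} = {b m |b. b \<in> B}) \<longleftrightarrow>
      (\<Union>a \<in> A. perm_rel n a) = (\<Union>b \<in> B. perm_rel n b)" (is "(\<forall>m \<in> _. ?a m = ?b m) \<longleftrightarrow> _")
  proof
    assume "(\<Union>a \<in> A. perm_rel n a) = (\<Union>b \<in> B. perm_rel n b)"
    then have eq: "(SIGMA m:{1..n}. ?a m) = (SIGMA m:{1..n}. ?b m)"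
      unfolding union .
    have fibre: "(SIGMA m:{1..n}. f m) `` {m} = f m" if "m \<in> {1..n}" for f :: "nat \<Rightarrow> nat set" and m
      using that by auto
    show "\<forall>m \<in> {1..n}. ?a m = ?b m"
    proof
      fix m assume m: "m \<in> {1..n}"
      have "?a m = (SIGMA m:{1..n}. ?a m) `` {m}"
        by (rule fibre[OF m, symmetric])
      also have "\<dots> = (SIGMA m:{1..n}. ?b m) `` {m}"
        by (simp only: eq)
      also have "\<dots> = ?b m"
        by (rule fibre[OF m])
      finally show "?a m = ?b m" .
    qed
  qed (unfold union, rule Sigma_cong, auto)
  then show ?thesis
    unfolding FP_rel_def by simp
qed

lemma class_rel_class:
  assumes "A \<subseteq> carrier (sym_group n)" "A \<noteq> {}"
  shows "class_rel n (FP_rel n `` {A}) = (\<Union>a \<in> A. perm_rel n a)"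
proof -
  have "A \<in> FP_rel n `` {A}"
    using assms by (simp add: FP_rel_iff)
  moreover have "(\<Union>b \<in> B. perm_rel n b) = (\<Union>a \<in> A. perm_rel n a)" if "B \<in> FP_rel n `` {A}" for B
    using that by (simp add: FP_rel_iff)
  ultimately show ?thesis
    unfolding class_rel_def by (metis (no_types, lifting) SUP_eqI order_refl)
qed

lemma FP_carrierE:
  assumes "X \<in> carrier (FP n)"
  obtains A where "A \<subseteq> carrier (sym_group n)" "A \<noteq> {}" "X = FP_rel n `` {A}"
  using assms unfolding FP_def quotient_def by auto

lemma FP_rel_class_closed:
  "A \<subseteq> carrier (sym_group n) \<Longrightarrow> A \<noteq> {} \<Longrightarrow> FP_rel n `` {A} \<in> carrier (FP n)"
  unfolding FP_def quotient_def by auto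

lemma class_rel_image: "class_rel n ` carrier (FP n) = hall_relations n"
proof
  show "class_rel n ` carrier (FP n) \<subseteq> hall_relations n"
  proof
    fix r assume "r \<in> class_rel n ` carrier (FP n)"
    then obtain A where "A \<subseteq> carrier (sym_group n)" "A \<noteq> {}" "r = class_rel n (FP_rel n `` {A})"
      by (auto elim: FP_carrierE)
    then show "r \<in> hall_relations n"
      unfolding hall_relations_def by (auto simp: class_rel_class)
  qed
  show "hall_relations n \<subseteq> class_rel n ` carrier (FP n)"
  proof
    fix r assume "r \<in> hall_relations n"
    then obtain A where A: "A \<subseteq> carrier (sym_group n)" "A \<noteq> {}" "r = (\<Union>a \<in> A. perm_rel n a)"
      unfolding hall_relations_def by blast
    then show "r \<in> class_rel n ` carrier (FP n)"
      using FP_rel_class_closed[OF A(1,2)] class_rel_class[OF A(1,2)] by (metis image_eqI)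
  qed
qed

lemma class_rel_inj: "inj_on (class_rel n) (carrier (FP n))"
proof (rule inj_onI)
  fix X Y assume XY: "X \<in> carrier (FP n)" "Y \<in> carrier (FP n)" "class_rel n X = class_rel n Y"
  obtain A where A: "A \<subseteq> carrier (sym_group n)" "A \<noteq> {}" "X = FP_rel n `` {A}"
    using XY(1) by (rule FP_carrierE)
  obtain B where B: "B \<subseteq> carrier (sym_group n)" "B \<noteq> {}" "Y = FP_rel n `` {B}"
    using XY(2) by (rule FP_carrierE)
  have "(A, B) \<in> FP_rel n"
    using XY(3) A B unfolding FP_rel_iff by (simp add: class_rel_class)
  then show "X = Y"
    unfolding A(3) B(3) by (rule equiv_class_eq[OF equiv_FP_rel])
qed

lemma class_rel_mult:
  assumes "X \<in> carrier (FP n)" "Y \<in> carrier (FP n)"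
  shows "X \<otimes>\<^bsub>FP n\<^esub> Y \<in> carrier (FP n)"
    and "class_rel n (X \<otimes>\<^bsub>FP n\<^esub> Y) = class_rel n X \<cdot>\<^sub>r class_rel n Y"
proof -
  obtain A where A: "A \<subseteq> carrier (sym_group n)" "A \<noteq> {}" "X = FP_rel n `` {A}"
    using assms(1) by (rule FP_carrierE)
  obtain B where B: "B \<subseteq> carrier (sym_group n)" "B \<noteq> {}" "Y = FP_rel n `` {B}"
    using assms(2) by (rule FP_carrierE)
  have AB: "A <#>\<^bsub>sym_group n\<^esub> B \<subseteq> carrier (sym_group n)" "A <#>\<^bsub>sym_group n\<^esub> B \<noteq> {}"
    using monoid.set_mult_closed[OF group.is_monoid[OF sym_group_is_group] A(1) B(1)] A(2) B(2)
    by (auto simp: set_mult_def)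
  show "X \<otimes>\<^bsub>FP n\<^esub> Y \<in> carrier (FP n)"
    unfolding A(3) B(3) FP_mult_class[OF A(1,2) B(1,2)] by (rule FP_rel_class_closed[OF AB])
  have "perm_rel n (a \<circ> b) = perm_rel n a \<cdot>\<^sub>r perm_rel n b" if "b \<in> B" for a b
    using B(1) that sym_group_carrier perm_rel_comp by blast
  then have "(\<Union>c \<in> A <#>\<^bsub>sym_group n\<^esub> B. perm_rel n c) =
      (\<Union>a \<in> A. perm_rel n a) \<cdot>\<^sub>r (\<Union>b \<in> B. perm_rel n b)"
    unfolding set_mult_def sym_group_mult rel_prod_def relcomp_UNION_distrib relcomp_UNION_distrib2
    by auto
  then show "class_rel n (X \<otimes>\<^bsub>FP n\<^esub> Y) = class_rel n X \<cdot>\<^sub>r class_rel n Y"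
    unfolding A(3) B(3) FP_mult_class[OF A(1,2) B(1,2)]
      class_rel_class[OF A(1,2)] class_rel_class[OF B(1,2)] class_rel_class[OF AB] .
qed

lemma class_rel_one:
  "\<one>\<^bsub>FP n\<^esub> \<in> carrier (FP n)" "class_rel n \<one>\<^bsub>FP n\<^esub> = Id_on {1..n}"
proof -
  have id: "{\<one>\<^bsub>sym_group n\<^esub>} \<subseteq> carrier (sym_group n)"
    by (simp add: sym_group_one sym_group_carrier permutes_id)
  have one: "\<one>\<^bsub>FP n\<^esub> = FP_rel n `` {{\<one>\<^bsub>sym_group n\<^esub>}}"
    by (simp add: FP_def)
  show "\<one>\<^bsub>FP n\<^esub> \<in> carrier (FP n)"
    unfolding one by (rule FP_rel_class_closed[OF id]) simp
  have "class_rel n \<one>\<^bsub>FP n\<^esub> = perm_rel n id"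
    unfolding one by (subst class_rel_class[OF id]) (simp_all add: sym_group_one)
  then show "class_rel n \<one>\<^bsub>FP n\<^esub> = Id_on {1..n}"
    unfolding perm_rel_def Id_on_def by auto
qed

lemma perm_rel_subset: "\<sigma> permutes {1..n} \<Longrightarrow> perm_rel n \<sigma> \<subseteq> {1..n} \<times> {1..n}"
  unfolding perm_rel_def by (auto simp only: permutes_in_image)

lemma hall_relation_subset: "r \<in> hall_relations n \<Longrightarrow> r \<subseteq> {1..n} \<times> {1..n}"
  unfolding hall_relations_def using perm_rel_subset sym_group_carrier by blast

text \<open>The laws are pulled back along the injection \<open>class_rel n\<close> from composition
  of relations, and there are only finitely many relations on \<open>{1..n}\<close>.\<close>

lemma finite_monoid_FP: "finite_monoid (FP n)"
proof (intro finite_monoid.intro finite_monoid_axioms.intro monoidI)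
  fix X Y Z assume *: "X \<in> carrier (FP n)" "Y \<in> carrier (FP n)" "Z \<in> carrier (FP n)"
  show "X \<otimes>\<^bsub>FP n\<^esub> Y \<otimes>\<^bsub>FP n\<^esub> Z = X \<otimes>\<^bsub>FP n\<^esub> (Y \<otimes>\<^bsub>FP n\<^esub> Z)"
    by (rule inj_onD[OF class_rel_inj[of n]]) (simp_all add: class_rel_mult * rel_prod_def O_assoc)
next
  fix X assume X: "X \<in> carrier (FP n)"
  then have "class_rel n X \<subseteq> {1..n} \<times> {1..n}"
    using hall_relation_subset class_rel_image by blast
  then have "Id_on {1..n} \<cdot>\<^sub>r class_rel n X = class_rel n X" "class_rel n X \<cdot>\<^sub>r Id_on {1..n} = class_rel n X"
    unfolding rel_prod_def by auto
  then show "\<one>\<^bsub>FP n\<^esub> \<otimes>\<^bsub>FP n\<^esub> X = X" "X \<otimes>\<^bsub>FP n\<^esub> \<one>\<^bsub>FP n\<^esub> = X"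
    by (intro inj_onD[OF class_rel_inj[of n]]; simp add: class_rel_mult class_rel_one X del: One_nat_def)+
next
  have "hall_relations n \<subseteq> Pow ({1..n} \<times> {1..n})"
    using hall_relation_subset by blast
  then have "finite (hall_relations n)"
    by (rule finite_subset) simp
  then show "finite (carrier (FP n))"
    using finite_imageD[OF _ class_rel_inj] class_rel_image by metis
qed (simp_all add: class_rel_mult class_rel_one)

section \<open>Permutations contained in a relation\<close>

lemma hall_relationE:
  assumes "r \<in> hall_relations n"
  obtains \<sigma> where "\<sigma> permutes {1..n}" "perm_rel n \<sigma> \<subseteq> r"
proof -
  obtain A where A: "A \<subseteq> carrier (sym_group n)" "A \<noteq> {}" "r = (\<Union>a \<in> A. perm_rel n a)"
    using assms unfolding hall_relations_def by blast
  then obtain \<sigma> where "\<sigma> \<in> A" by blast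
  then show ?thesis
    using A that[of \<sigma>] sym_group_carrier by blast
qed

lemma hall_relation_edgeE:
  assumes "r \<in> hall_relations n" "(m, k) \<in> r"
  obtains \<sigma> where "\<sigma> permutes {1..n}" "perm_rel n \<sigma> \<subseteq> r" "\<sigma> m = k"
proof -
  obtain A where A: "A \<subseteq> carrier (sym_group n)" "A \<noteq> {}" "r = (\<Union>a \<in> A. perm_rel n a)"
    using assms unfolding hall_relations_def by blast
  then obtain \<sigma> where "\<sigma> \<in> A" "(m, k) \<in> perm_rel n \<sigma>"
    using assms(2) by blast
  then show ?thesis
    using A that[of \<sigma>] sym_group_carrier by (auto simp: mem_perm_rel)
qed

text \<open>For positive \<open>n\<close> a pair in \<open>r\<close> provides a permutation below
  \<open>r\<close>; for \<open>n = 0\<close> the empty relation is itself the graph of the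
  identity.\<close>

lemma hall_relationI:
  assumes "r \<noteq> {} \<or> n = 0" "\<And>m k. (m, k) \<in> r \<Longrightarrow> m \<in> {1..n} \<and> (\<exists>\<sigma>. \<sigma> permutes {1..n} \<and> perm_rel n \<sigma> \<subseteq> r \<and> \<sigma> m = k)"
  shows "r \<in> hall_relations n"
proof -
  define A where "A = {\<sigma>. \<sigma> permutes {1..n} \<and> perm_rel n \<sigma> \<subseteq> r}"
  have "r \<subseteq> (\<Union>a \<in> A. perm_rel n a)"
    using assms(2) unfolding A_def by (fastforce simp: mem_perm_rel)
  then have "r = (\<Union>a \<in> A. perm_rel n a)"
    unfolding A_def by blast
  moreover have "A \<noteq> {}"
  proof (cases "n = 0")
    case True
    then have "id \<in> A"
      unfolding A_def by (simp add: perm_rel_def permutes_id)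
    then show ?thesis by blast
  next
    case False
    then obtain m k where "(m, k) \<in> r"
      using assms(1) by auto
    then show ?thesis
      using assms(2) unfolding A_def by blast
  qed
  moreover have "A \<subseteq> carrier (sym_group n)"
    unfolding A_def using sym_group_carrier by blast
  ultimately show ?thesis
    unfolding hall_relations_def by blast
qed

text \<open>The inverses of the permutations below \<open>r\<close> cover the converse. This will
  provide transposes in the matrix representation.\<close>

lemma hall_relation_converse:
  assumes "r \<in> hall_relations n"
  shows "r\<inverse> \<in> hall_relations n"
proof (rule hall_relationI)
  obtain \<sigma> where "perm_rel n \<sigma> \<subseteq> r"
    using assms by (rule hall_relationE)
  moreover have "(1, \<sigma> 1) \<in> perm_rel n \<sigma>" if "n \<noteq> 0"
    using that by (auto simp: mem_perm_rel)
  ultimately show "r\<inverse> \<noteq> {} \<or> n = 0"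
    by blast
next
  fix m k assume "(m, k) \<in> r\<inverse>"
  then have "(k, m) \<in> r" by simp
  then obtain \<sigma> where \<sigma>: "\<sigma> permutes {1..n}" "perm_rel n \<sigma> \<subseteq> r" "\<sigma> k = m"
    using hall_relation_edgeE[OF assms] by blast
  have "perm_rel n (inv' \<sigma>) \<subseteq> r\<inverse>"
  proof (rule subrelI)
    fix i j assume "(i, j) \<in> perm_rel n (inv' \<sigma>)"
    then have "(j, i) \<in> perm_rel n \<sigma>"
      using \<sigma>(1) permutes_in_image[OF permutes_inv[OF \<sigma>(1)], of i]
      by (auto simp: mem_perm_rel permutes_inverses)
    then show "(i, j) \<in> r\<inverse>" using \<sigma>(2) by blast
  qed
  moreover have "inv' \<sigma> m = k"
    using permutes_inverses(2)[OF \<sigma>(1), of k] \<sigma>(3) by simp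
  moreover have "m \<in> {1..n}"
    using \<open>(k, m) \<in> r\<close> hall_relation_subset[OF assms] by blast
  ultimately show "m \<in> {1..n} \<and> (\<exists>\<sigma>. \<sigma> permutes {1..n} \<and> perm_rel n \<sigma> \<subseteq> r\<inverse> \<and> \<sigma> m = k)"
    using permutes_inv[OF \<sigma>(1)] by blast
qed

lemma factorizable_dual_hall:
  assumes \<rho>: "equiv {1..n} \<rho>" and \<sigma>: "\<sigma> permutes {1..n}"
  shows "\<rho> \<cdot>\<^sub>r perm_rel n \<sigma> \<in> hall_relations n"
proof (rule hall_relationI)
  have "(1, \<sigma> 1) \<in> \<rho> \<cdot>\<^sub>r perm_rel n \<sigma>" if "n \<noteq> 0"
    using that \<rho> permutes_in_image[OF \<sigma>, of 1] unfolding mem_rel_perm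
    by (auto simp: equiv_def refl_on_def)
  then show "\<rho> \<cdot>\<^sub>r perm_rel n \<sigma> \<noteq> {} \<or> n = 0"
    by blast
next
  fix m k assume "(m, k) \<in> \<rho> \<cdot>\<^sub>r perm_rel n \<sigma>"
  then have mk: "m \<in> {1..n}" "(\<sigma> m, k) \<in> \<rho>"
    by (auto simp: mem_rel_perm)
  \<comment> \<open>The transposition redirects \<open>m\<close> to \<open>k\<close>. It exchanges
    points of one block of \<open>\<rho>\<close>, so the graph of \<open>\<tau>\<close> stays inside
    the given relation.\<close>
  define \<tau> where "\<tau> = transpose (\<sigma> m) k \<circ> \<sigma>"
  have "\<sigma> m \<in> {1..n}" "k \<in> {1..n}"
    using mk \<rho> by (auto simp: equiv_def)
  then have "\<tau> permutes {1..n}"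
    unfolding \<tau>_def by (intro permutes_compose \<sigma> permutes_swap_id)
  moreover have "(\<sigma> i, \<tau> i) \<in> \<rho>" if "i \<in> {1..n}" for i
  proof -
    have "(\<sigma> i, \<sigma> i) \<in> \<rho>" "(k, \<sigma> m) \<in> \<rho>"
      using that permutes_in_image[OF \<sigma>, of i] mk(2) \<rho> by (auto simp: equiv_def refl_on_def dest: symD)
    then show ?thesis
      using mk(2) by (auto simp: \<tau>_def transpose_def)
  qed
  then have "perm_rel n \<tau> \<subseteq> \<rho> \<cdot>\<^sub>r perm_rel n \<sigma>"
    unfolding mem_rel_perm mem_perm_rel subset_iff by (auto simp: mem_rel_perm mem_perm_rel)
  moreover have "\<tau> m = k"
    by (simp add: \<tau>_def)
  ultimately show "m \<in> {1..n} \<and> (\<exists>\<tau>. \<tau> permutes {1..n} \<and> perm_rel n \<tau> \<subseteq> \<rho> \<cdot>\<^sub>r perm_rel n \<sigma> \<and> \<tau> m = k)"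
    using mk(1) by blast
qed

section \<open>Labellings intertwined by a relation\<close>

definition intertwines :: "(nat \<times> nat) set \<Rightarrow> (nat \<Rightarrow> nat set) \<Rightarrow> (nat \<Rightarrow> nat set) \<Rightarrow> bool"
  where "intertwines r f g \<longleftrightarrow> (\<forall>(m, k) \<in> r. g m = f k)"

text \<open>View \<open>r\<close> as a bipartite graph between two copies of \<open>{1..n}\<close>.
  An intertwined pair labels targets by \<open>f\<close> and sources by \<open>g\<close> so that the
  ends of each edge agree; hence the hull relates \<open>m\<close> to \<open>k\<close> when both lie
  in one connected component. For unions of permutation graphs it is the least element of the dual
  monoid above \<open>r\<close>.\<close>

definition biequiv_hull :: "nat \<Rightarrow> (nat \<times> nat) set \<Rightarrow> (nat \<times> nat) set"
  where "biequiv_hull n r = {(m, k) \<in> {1..n} \<times> {1..n}. \<forall>f g. intertwines r f g \<longrightarrow> g m = f k}"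

text \<open>Two targets are related when they lie in one component; this is the equivalence factor
  of the hull.\<close>

definition hull_ker :: "nat \<Rightarrow> (nat \<times> nat) set \<Rightarrow> (nat \<times> nat) set"
  where "hull_ker n r = {(j, k) \<in> {1..n} \<times> {1..n}. \<forall>f g. intertwines r f g \<longrightarrow> f j = f k}"

lemma intertwinesD: "intertwines r f g \<Longrightarrow> (m, k) \<in> r \<Longrightarrow> g m = f k"
  unfolding intertwines_def by blast

lemma intertwines_converse: "intertwines (r\<inverse>) f g \<longleftrightarrow> intertwines r g f"
  unfolding intertwines_def by auto

text \<open>The labels of the middle copy are read off along a permutation \<open>\<tau>\<close>
  inside \<open>r\<close>. They agree with all of \<open>r\<close> because \<open>s\<close> leads
  from some source to each middle point.\<close>

lemma intertwines_mult:
  assumes r: "r \<in> hall_relations n" and s: "s \<in> hall_relations n"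
  shows "intertwines (r \<cdot>\<^sub>r s) f g \<longleftrightarrow> (\<exists>h. intertwines r f h \<and> intertwines s h g)"
proof
  assume *: "intertwines (r \<cdot>\<^sub>r s) f g"
  obtain \<tau> where \<tau>: "\<tau> permutes {1..n}" "perm_rel n \<tau> \<subseteq> r"
    using r by (rule hall_relationE)
  obtain \<sigma> where \<sigma>: "\<sigma> permutes {1..n}" "perm_rel n \<sigma> \<subseteq> s"
    using s by (rule hall_relationE)
  define h where "h j = f (\<tau> j)" for j
  have key: "g m = f k" if "(m, j) \<in> s" "(j, k) \<in> r" for m j k
    using * that unfolding intertwines_def rel_prod_def by blast
  have "intertwines r f h"
    unfolding intertwines_def
  proof clarify
    fix j k assume jk: "(j, k) \<in> r"
    then have j: "j \<in> {1..n}"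
      using hall_relation_subset[OF r] by blast
    then have "j \<in> \<sigma> ` {1..n}"
      by (simp only: permutes_image[OF \<sigma>(1)])
    then obtain m where m: "m \<in> {1..n}" "\<sigma> m = j"
      by blast
    have "(m, j) \<in> s" "(j, \<tau> j) \<in> r"
      using \<sigma>(2) \<tau>(2) m j by (auto simp: subset_iff mem_perm_rel)
    then show "h j = f k"
      using key jk unfolding h_def by metis
  qed
  moreover have "intertwines s h g"
    unfolding intertwines_def
  proof clarify
    fix m j assume mj: "(m, j) \<in> s"
    then have "j \<in> {1..n}"
      using hall_relation_subset[OF s] by blast
    then have "(j, \<tau> j) \<in> r"
      using \<tau>(2) by (auto simp: subset_iff mem_perm_rel)
    then show "g m = h j"
      using key mj unfolding h_def by blast
  qed
  ultimately show "\<exists>h. intertwines r f h \<and> intertwines s h g"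
    by blast
next
  assume "\<exists>h. intertwines r f h \<and> intertwines s h g"
  then show "intertwines (r \<cdot>\<^sub>r s) f g"
    unfolding rel_prod_def intertwines_def by fastforce
qed

lemma intertwines_cong:
  assumes "r \<subseteq> {1..n} \<times> {1..n}" "\<And>m. m \<in> {1..n} \<Longrightarrow> f m = f' m" "\<And>m. m \<in> {1..n} \<Longrightarrow> g m = g' m"
  shows "intertwines r f g \<longleftrightarrow> intertwines r f' g'"
proof -
  have "g m = f k \<longleftrightarrow> g' m = f' k" if "(m, k) \<in> r" for m k
    using assms that by (metis SigmaE2 subsetD)
  then show ?thesis
    unfolding intertwines_def by (intro ball_cong refl) (simp add: split_paired_all)
qed

lemma subset_biequiv_hull: "r \<subseteq> {1..n} \<times> {1..n} \<Longrightarrow> r \<subseteq> biequiv_hull n r"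
  unfolding biequiv_hull_def intertwines_def by auto

lemma biequiv_hull_mono: "r \<subseteq> s \<Longrightarrow> biequiv_hull n r \<subseteq> biequiv_hull n s"
  unfolding biequiv_hull_def intertwines_def by blast

lemma equiv_hull_ker: "equiv {1..n} (hull_ker n r)"
  unfolding hull_ker_def by (intro equivI refl_onI symI transI) auto

text \<open>The edge from \<open>m\<close> to \<open>\<sigma> m\<close> forces
  \<open>g m = f (\<sigma> m)\<close>, so the condition on \<open>m\<close> and \<open>k\<close>
  becomes one on the targets \<open>\<sigma> m\<close> and \<open>k\<close>.\<close>

lemma biequiv_hull_eq:
  assumes "\<sigma> permutes {1..n}" "perm_rel n \<sigma> \<subseteq> r"
  shows "biequiv_hull n r = hull_ker n r \<cdot>\<^sub>r perm_rel n \<sigma>"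
proof -
  have "(m, k) \<in> biequiv_hull n r \<longleftrightarrow> (m, k) \<in> hull_ker n r \<cdot>\<^sub>r perm_rel n \<sigma>" for m k
  proof (cases "m \<in> {1..n}")
    case True
    then have "(m, \<sigma> m) \<in> r" "\<sigma> m \<in> {1..n}"
      using assms permutes_in_image[OF assms(1), of m] by (auto simp: subset_iff mem_perm_rel)
    then have "g m = f (\<sigma> m)" if "intertwines r f g" for f g
      using that intertwinesD by blast
    then show ?thesis
      unfolding mem_rel_perm hull_ker_def biequiv_hull_def
      using True \<open>\<sigma> m \<in> {1..n}\<close> by (simp only: mem_Collect_eq prod.case mem_Sigma_iff) metis
  next
    case False
    then show ?thesis
      unfolding mem_rel_perm biequiv_hull_def by blast
  qed
  then show ?thesis by auto
qed

section \<open>Elements of the dual monoid and their block labellings\<close>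

lemma factorizable_dual_carrier:
  "t \<in> carrier (factorizable_dual n) \<longleftrightarrow>
    (\<exists>\<rho> \<sigma>. t = \<rho> \<cdot>\<^sub>r perm_rel n \<sigma> \<and> equiv {1..n} \<rho> \<and> \<sigma> permutes {1..n})"
  unfolding factorizable_dual_def by (auto simp: sym_group_carrier)

text \<open>The neighbourhood of \<open>m\<close> in \<open>t\<close> is the block of
  \<open>\<sigma> m\<close>, and two points are related exactly when their blocks coincide.\<close>

lemma factorizable_dual_mem_iff:
  assumes \<rho>: "equiv {1..n} \<rho>" and \<sigma>: "\<sigma> permutes {1..n}" and "t = \<rho> \<cdot>\<^sub>r perm_rel n \<sigma>"
    and "m \<in> {1..n}" "k \<in> {1..n}"
  shows "(m, k) \<in> t \<longleftrightarrow> t `` {m} = \<rho> `` {k}"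
proof -
  have "t `` {m} = \<rho> `` {\<sigma> m}"
    using assms(3,4) by (auto simp: mem_rel_perm)
  then show ?thesis
    using assms eq_equiv_class_iff[OF \<rho>, of "\<sigma> m" k] permutes_in_image[OF \<sigma>, of m]
    by (simp add: mem_rel_perm)
qed

text \<open>Blocks used as labels test containment in \<open>t\<close>. This pair of labellings
  serves both for the fixed points of the hull and for the faithfulness of the matrix representation
  on the dual monoid.\<close>

lemma intertwines_factorizable_dual:
  assumes "equiv {1..n} \<rho>" "\<sigma> permutes {1..n}" "t = \<rho> \<cdot>\<^sub>r perm_rel n \<sigma>" "r \<subseteq> {1..n} \<times> {1..n}"
  shows "intertwines r (\<lambda>k. \<rho> `` {k}) (\<lambda>m. t `` {m}) \<longleftrightarrow> r \<subseteq> t"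
  unfolding intertwines_def using factorizable_dual_mem_iff[OF assms(1-3)] assms(4) by blast

text \<open>As \<open>t\<close> intertwines its own block labellings, the hull adds no pair. With
  monotonicity this makes hulls least among the elements of the dual monoid above a
  relation.\<close>

lemma biequiv_hull_factorizable_dual:
  assumes "t \<in> carrier (factorizable_dual n)"
  shows "biequiv_hull n t = t"
proof -
  obtain \<rho> \<sigma> where *: "equiv {1..n} \<rho>" "\<sigma> permutes {1..n}" "t = \<rho> \<cdot>\<^sub>r perm_rel n \<sigma>"
    using assms factorizable_dual_carrier by blast
  then have t: "t \<subseteq> {1..n} \<times> {1..n}"
    using hall_relation_subset factorizable_dual_hall by blast
  have "biequiv_hull n t \<subseteq> t"
  proof (rule subrelI)
    fix m k assume mk: "(m, k) \<in> biequiv_hull n t"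
    then have "t `` {m} = \<rho> `` {k}"
      using intertwines_factorizable_dual[OF * t] unfolding biequiv_hull_def by auto
    then show "(m, k) \<in> t"
      using mk factorizable_dual_mem_iff[OF *] unfolding biequiv_hull_def by auto
  qed
  then show ?thesis
    using subset_biequiv_hull[OF t] by blast
qed

lemma biequiv_hull_closed:
  assumes "r \<in> hall_relations n"
  shows "biequiv_hull n r \<in> carrier (factorizable_dual n)"
proof -
  obtain \<sigma> where "\<sigma> permutes {1..n}" "perm_rel n \<sigma> \<subseteq> r"
    using assms by (rule hall_relationE)
  then show ?thesis
    unfolding factorizable_dual_carrier
    using biequiv_hull_eq equiv_hull_ker by blast
qed

section \<open>Multiplicativity of the hull\<close>

text \<open>A pair in \<open>?C\<close> combines a step within a component of \<open>s\<close>,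
  carried over by \<open>\<sigma>\<close>, with one within a component of \<open>r\<close>, so no
  labelling of the product separates it. Conversely, the blocks of an equivalence above
  \<open>?C\<close> give labels compatible with \<open>r\<close> and \<open>s\<close>.\<close>

lemma hull_ker_mult:
  assumes r: "r \<in> hall_relations n" and s: "s \<in> hall_relations n"
    and \<sigma>: "\<sigma> permutes {1..n}" "perm_rel n \<sigma> \<subseteq> r"
    and \<tau>: "\<tau> permutes {1..n}" "perm_rel n \<tau> \<subseteq> s"
  shows "hull_ker n (r \<cdot>\<^sub>r s) =
    equiv_hull n (hull_ker n r \<cdot>\<^sub>r perm_rel n \<sigma> \<cdot>\<^sub>r hull_ker n s \<cdot>\<^sub>r perm_rel n (inv' \<sigma>))"
    (is "_ = equiv_hull n ?C")
proof
  have "(x, y) \<in> hull_ker n (r \<cdot>\<^sub>r s)" if xy: "(x, y) \<in> ?C" for x y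
  proof -
    obtain a b where ab: "a \<in> {1..n}" "b \<in> {1..n}" "x = \<sigma> a" "(a, b) \<in> hull_ker n s" "(\<sigma> b, y) \<in> hull_ker n r"
      using xy unfolding mem_conj[OF \<sigma>(1)] by blast
    have "f x = f y" if fg: "intertwines (r \<cdot>\<^sub>r s) f g" for f g
    proof -
      obtain h where h: "intertwines r f h" "intertwines s h g"
        using fg intertwines_mult[OF r s] by blast
      have "h a = h b"
        using ab(4) h(2) unfolding hull_ker_def by blast
      moreover have "h a = f (\<sigma> a)" "h b = f (\<sigma> b)"
        using ab(1,2) \<sigma>(2) by (auto intro!: intertwinesD[OF h(1)] simp: mem_perm_rel subset_iff)
      moreover have "f (\<sigma> b) = f y"
        using ab(5) h(1) unfolding hull_ker_def by blast
      ultimately show ?thesis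
        using ab(3) by simp
    qed
    moreover have "x \<in> {1..n}" "y \<in> {1..n}"
      using ab permutes_in_image[OF \<sigma>(1)] unfolding hull_ker_def by auto
    ultimately show ?thesis
      unfolding hull_ker_def by blast
  qed
  then show "equiv_hull n ?C \<subseteq> hull_ker n (r \<cdot>\<^sub>r s)"
    unfolding equiv_hull_def using equiv_hull_ker by (intro Inter_lower) auto
next
  have "hull_ker n (r \<cdot>\<^sub>r s) \<subseteq> \<epsilon>" if \<epsilon>: "equiv {1..n} \<epsilon>" "?C \<subseteq> \<epsilon>" for \<epsilon>
  proof (rule subrelI)
    fix x y assume xy: "(x, y) \<in> hull_ker n (r \<cdot>\<^sub>r s)"
    have ker: "(\<sigma> a, y) \<in> \<epsilon>"
      if "a \<in> {1..n}" "(a, b) \<in> hull_ker n s" "(\<sigma> b, y) \<in> hull_ker n r" for a b y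
    proof -
      have "b \<in> {1..n}"
        using that(2) unfolding hull_ker_def by blast
      then have "(\<sigma> a, y) \<in> ?C"
        unfolding mem_conj[OF \<sigma>(1)] using that by blast
      then show ?thesis using \<epsilon>(2) by blast
    qed
    have ker_refl: "(a, a) \<in> hull_ker n q" if "a \<in> {1..n}" for a q
      using that unfolding hull_ker_def by blast
    \<comment> \<open>Targets are labelled by their blocks of \<open>\<epsilon>\<close>; middle
      points and sources inherit labels along \<open>\<sigma>\<close> and
      \<open>\<sigma> \<circ> \<tau>\<close>.\<close>
    define f where "f k = \<epsilon> `` {k}" for k
    have f: "f j = f k" if "(j, k) \<in> \<epsilon>" for j k
      unfolding f_def using \<epsilon>(1) that by (rule equiv_class_eq)
    have "intertwines r f (\<lambda>j. f (\<sigma> j))"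
      unfolding intertwines_def
    proof clarify
      fix j k assume jk: "(j, k) \<in> r"
      then have "j \<in> {1..n}" "(j, k) \<in> biequiv_hull n r"
        using hall_relation_subset[OF r] subset_biequiv_hull by blast+
      then show "f (\<sigma> j) = f k"
        unfolding biequiv_hull_eq[OF \<sigma>] mem_rel_perm using ker ker_refl f by blast
    qed
    moreover have "intertwines s (\<lambda>j. f (\<sigma> j)) (\<lambda>m. f (\<sigma> (\<tau> m)))"
      unfolding intertwines_def
    proof clarify
      fix m j assume mj: "(m, j) \<in> s"
      then have m: "m \<in> {1..n}" "j \<in> {1..n}" "(m, j) \<in> biequiv_hull n s"
        using hall_relation_subset[OF s] subset_biequiv_hull by blast+
      then have "(\<tau> m, j) \<in> hull_ker n s" "\<tau> m \<in> {1..n}" "\<sigma> j \<in> {1..n}"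
        unfolding biequiv_hull_eq[OF \<tau>] mem_rel_perm
        using permutes_in_image[OF \<tau>(1)] permutes_in_image[OF \<sigma>(1)] by auto
      then show "f (\<sigma> (\<tau> m)) = f (\<sigma> j)"
        using ker ker_refl f by blast
    qed
    ultimately have "intertwines (r \<cdot>\<^sub>r s) f (\<lambda>m. f (\<sigma> (\<tau> m)))"
      using intertwines_mult[OF r s] by blast
    then have "f x = f y"
      using xy unfolding hull_ker_def by blast
    then show "(x, y) \<in> \<epsilon>"
      using xy eq_equiv_class_iff[OF \<epsilon>(1)] unfolding f_def hull_ker_def by blast
  qed
  then show "hull_ker n (r \<cdot>\<^sub>r s) \<subseteq> equiv_hull n ?C"
    unfolding equiv_hull_def by blast
qed

text \<open>The graph of \<open>\<sigma> \<circ> \<tau>\<close> lies in the product, and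
  \<open>hull_ker_mult\<close> yields exactly the equivalence that \<open>dual_mult\<close>
  prescribes when the two hulls are factorized through \<open>\<sigma>\<close> and
  \<open>\<tau>\<close>.\<close>

lemma biequiv_hull_mult:
  assumes r: "r \<in> hall_relations n" and s: "s \<in> hall_relations n"
  shows "biequiv_hull n (r \<cdot>\<^sub>r s) = biequiv_hull n r \<otimes>\<^bsub>factorizable_dual n\<^esub> biequiv_hull n s"
proof -
  obtain \<sigma> where \<sigma>: "\<sigma> permutes {1..n}" "perm_rel n \<sigma> \<subseteq> r"
    using r by (rule hall_relationE)
  obtain \<tau> where \<tau>: "\<tau> permutes {1..n}" "perm_rel n \<tau> \<subseteq> s"
    using s by (rule hall_relationE)
  have "perm_rel n (\<sigma> \<circ> \<tau>) \<subseteq> r \<cdot>\<^sub>r s"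
    using \<sigma>(2) \<tau>(2) unfolding perm_rel_comp[OF \<tau>(1)] rel_prod_def by blast
  then have "biequiv_hull n (r \<cdot>\<^sub>r s) = hull_ker n (r \<cdot>\<^sub>r s) \<cdot>\<^sub>r perm_rel n (\<sigma> \<circ> \<tau>)"
    by (intro biequiv_hull_eq permutes_compose \<sigma> \<tau>)
  also have "\<dots> = dual_mult n (biequiv_hull n r) (biequiv_hull n s)"
    unfolding hull_ker_mult[OF r s \<sigma> \<tau>] biequiv_hull_eq[OF \<sigma>] biequiv_hull_eq[OF \<tau>]
    by (subst dual_mult_eq)
      (use equiv_hull_ker sym_group_carrier \<sigma> \<tau> in \<open>simp_all add: sym_group_mult\<close>)
  finally show ?thesis
    by (simp add: factorizable_dual_def)
qed


section \<open>The radical of the algebra of classes\<close>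

text \<open>After the homomorphism theorem for rings, compatibility with scalars remains. On the
  union of cosets defining a scalar multiple \<open>h\<close> takes a single value, which is
  therefore the value of the induced map.\<close>

lemma quotient_algebra_kernel_iso:
  fixes A :: "'a calgebra" and B :: "'b calgebra"
  assumes hom: "ring_hom_ring A B h" and surj: "h ` carrier A = carrier B"
    and closed: "\<And>c x. x \<in> carrier A \<Longrightarrow> c \<odot>\<^bsub>A\<^esub> x \<in> carrier A"
    and scale: "\<And>c x. x \<in> carrier A \<Longrightarrow> h (c \<odot>\<^bsub>A\<^esub> x) = c \<odot>\<^bsub>B\<^esub> h x"
  shows "is_algebra_iso (quotient_algebra A (a_kernel A B h)) B"
proof -
  interpret ring_hom_ring A B h by fact
  define K where "K = a_kernel A B h"
  have K: "K = {k \<in> carrier A. h k = \<zero>\<^bsub>B\<^esub>}"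
    unfolding K_def a_kernel_def' ..
  have mem: "y \<in> carrier A" "h y = h x" if x: "x \<in> carrier A" and y: "y \<in> K +>\<^bsub>A\<^esub> x" for x y
  proof -
    obtain k where k: "k \<in> carrier A" "h k = \<zero>\<^bsub>B\<^esub>" "y = k \<oplus>\<^bsub>A\<^esub> x"
      using y unfolding K a_r_coset_def' by blast
    show "y \<in> carrier A" "h y = h x"
      unfolding k(3) using k(1,2) x by simp_all
  qed
  have self: "x \<in> K +>\<^bsub>A\<^esub> x" if "x \<in> carrier A" for x
  proof -
    have "\<zero>\<^bsub>A\<^esub> \<in> K" "x = \<zero>\<^bsub>A\<^esub> \<oplus>\<^bsub>A\<^esub> x"
      using that by (simp_all add: K)
    then show ?thesis
      unfolding a_r_coset_def' by blast
  qed
  define \<psi> where "\<psi> X = the_elem (h ` X)" for X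
  have \<psi>: "\<psi> X = v" if "X \<noteq> {}" "\<And>y. y \<in> X \<Longrightarrow> h y = v" for X v
  proof -
    have "h ` X = {v}" using that by auto
    then show ?thesis by (simp add: \<psi>_def)
  qed
  have "\<psi> \<in> ring_iso (A Quot K) B"
    unfolding \<psi>_def K_def by (rule FactRing_iso_set[OF surj])
  then have "\<psi> \<in> ring_iso (quotient_algebra A K) B"
    unfolding ring_iso_def ring_hom_def quotient_algebra_def by (simp add: ring.defs)
  moreover have "\<psi> (c \<odot>\<^bsub>quotient_algebra A K\<^esub> X) = c \<odot>\<^bsub>B\<^esub> \<psi> X"
    if "X \<in> carrier (quotient_algebra A K)" for c X
  proof -
    have "X \<in> carrier (A Quot K)"
      using that by (simp add: quotient_algebra_def ring.defs)
    then obtain x where x: "x \<in> carrier A" "X = K +>\<^bsub>A\<^esub> x"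
      unfolding FactRing_def A_RCOSETS_def' by auto
    have "\<psi> X = h x"
    proof (rule \<psi>)
      show "X \<noteq> {}"
        using self[OF x(1)] unfolding x(2) by blast
    qed (use mem(2)[OF x(1)] in \<open>simp only: x(2)\<close>)
    moreover have "c \<odot>\<^bsub>quotient_algebra A K\<^esub> X = (\<Union>y \<in> X. K +>\<^bsub>A\<^esub> (c \<odot>\<^bsub>A\<^esub> y))"
      by (simp add: quotient_algebra_def ring.defs module.defs)
    moreover have "\<psi> (\<Union>y \<in> X. K +>\<^bsub>A\<^esub> (c \<odot>\<^bsub>A\<^esub> y)) = c \<odot>\<^bsub>B\<^esub> h x"
    proof (rule \<psi>)
      show "(\<Union>y \<in> X. K +>\<^bsub>A\<^esub> (c \<odot>\<^bsub>A\<^esub> y)) \<noteq> {}"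
        using self[OF x(1)] self[OF closed[OF x(1)]] unfolding x(2) by blast
      fix z assume "z \<in> (\<Union>y \<in> X. K +>\<^bsub>A\<^esub> (c \<odot>\<^bsub>A\<^esub> y))"
      then obtain y where y: "y \<in> X" "z \<in> K +>\<^bsub>A\<^esub> (c \<odot>\<^bsub>A\<^esub> y)"
        by blast
      then have "y \<in> carrier A" "h y = h x"
        using mem[OF x(1)] unfolding x(2) by auto
      then show "h z = c \<odot>\<^bsub>B\<^esub> h x"
        using mem(2)[OF closed y(2)] scale by simp
    qed
    ultimately show ?thesis by simp
  qed
  ultimately show ?thesis
    unfolding is_algebra_iso_def algebra_iso_def K_def by blast
qed

section \<open>The homomorphism onto the dual monoid\<close>

definition hull_map :: "nat \<Rightarrow> (nat \<Rightarrow> nat) set set \<Rightarrow> (nat \<times> nat) set"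
  where "hull_map n X = biequiv_hull n (class_rel n X)"

lemma class_rel_closed: "X \<in> carrier (FP n) \<Longrightarrow> class_rel n X \<in> hall_relations n"
  using class_rel_image by blast

lemma Id_on_factorizable_dual: "Id_on {1..n} \<in> carrier (factorizable_dual n)"
proof -
  have "equiv {1..n} (Id_on {1..n})"
    by (intro equivI refl_onI symI transI) auto
  moreover have "Id_on {1..n} = Id_on {1..n} \<cdot>\<^sub>r perm_rel n id"
    unfolding rel_prod_def perm_rel_def by auto
  ultimately show ?thesis
    unfolding factorizable_dual_carrier using permutes_id by blast
qed

lemma hull_map_hom: "hull_map n \<in> hom (FP n) (factorizable_dual n)"
  unfolding hom_def hull_map_def
  by (simp add: class_rel_closed biequiv_hull_closed class_rel_mult biequiv_hull_mult)

lemma hull_map_one: "hull_map n \<one>\<^bsub>FP n\<^esub> = \<one>\<^bsub>factorizable_dual n\<^esub>"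
  unfolding hull_map_def class_rel_one biequiv_hull_factorizable_dual[OF Id_on_factorizable_dual]
  by (simp add: factorizable_dual_def)

lemma factorizable_dual_subset_hall: "carrier (factorizable_dual n) \<subseteq> hall_relations n"
proof
  fix t assume "t \<in> carrier (factorizable_dual n)"
  then show "t \<in> hall_relations n"
    unfolding factorizable_dual_carrier using factorizable_dual_hall by blast
qed

lemma hull_map_surj: "hull_map n ` carrier (FP n) = carrier (factorizable_dual n)"
proof
  show "hull_map n ` carrier (FP n) \<subseteq> carrier (factorizable_dual n)"
    using hull_map_hom unfolding hom_def by blast
  show "carrier (factorizable_dual n) \<subseteq> hull_map n ` carrier (FP n)"
  proof
    fix t assume t: "t \<in> carrier (factorizable_dual n)"
    then have "t \<in> class_rel n ` carrier (FP n)"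
      unfolding class_rel_image using factorizable_dual_subset_hall by blast
    then show "t \<in> hull_map n ` carrier (FP n)"
      unfolding hull_map_def using biequiv_hull_factorizable_dual[OF t] by force
  qed
qed

text \<open>Monoid laws pass to the image of a surjective homomorphism, so associativity of
  \<open>dual_mult\<close> is inherited from \<open>FP n\<close>.\<close>

lemma finite_monoid_factorizable_dual: "finite_monoid (factorizable_dual n)"
proof -
  interpret finite_monoid "FP n" by (rule finite_monoid_FP)
  note mult = hom_mult[OF hull_map_hom, symmetric] and carrier = hull_map_surj[symmetric]
  show ?thesis
  proof (intro finite_monoid.intro finite_monoid_axioms.intro monoidI)
    show "finite (carrier (factorizable_dual n))"
      unfolding carrier using finite_carrier by (rule finite_imageI)
  qed (unfold carrier hull_map_one[symmetric], auto simp: mult m_assoc)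
qed

section \<open>Nilpotence of the kernel\<close>

lemma card_rel_prod_perm:
  assumes "p \<subseteq> {1..n} \<times> {1..n}" "\<tau> permutes {1..n}"
  shows "card (p \<cdot>\<^sub>r perm_rel n \<tau>) = card p"
proof -
  have "bij_betw (\<lambda>(m, k). (\<tau> m, k)) (p \<cdot>\<^sub>r perm_rel n \<tau>) p"
  proof (rule bij_betw_imageI)
    show "inj_on (\<lambda>(m, k). (\<tau> m, k)) (p \<cdot>\<^sub>r perm_rel n \<tau>)"
      using permutes_inj[OF assms(2)] by (auto simp: inj_on_def)
    have "(j, k) \<in> (\<lambda>(m, k). (\<tau> m, k)) ` (p \<cdot>\<^sub>r perm_rel n \<tau>)" if "(j, k) \<in> p" for j k
    proof -
      have "j \<in> \<tau> ` {1..n}"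
        unfolding permutes_image[OF assms(2)] using that assms(1) by blast
      then obtain m where "m \<in> {1..n}" "j = \<tau> m" by blast
      then show ?thesis
        using that by (intro image_eqI[of _ _ "(m, k)"]) (auto simp: mem_rel_perm)
    qed
    then show "(\<lambda>(m, k). (\<tau> m, k)) ` (p \<cdot>\<^sub>r perm_rel n \<tau>) = p"
      by (auto simp: mem_rel_perm)
  qed
  then show ?thesis
    by (rule bij_betw_same_card)
qed

lemma finite_hall_relation: "r \<in> hall_relations n \<Longrightarrow> finite r"
  using hall_relation_subset finite_subset[of r "{1..n} \<times> {1..n}"] by blast

lemma finite_rel_prod: "p \<in> hall_relations n \<Longrightarrow> r \<in> hall_relations n \<Longrightarrow> finite (p \<cdot>\<^sub>r r)"
  unfolding rel_prod_def by (intro finite_relcomp finite_hall_relation)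

text \<open>The part of the product along a single permutation in \<open>r\<close> already has as
  many pairs as \<open>p\<close>.\<close>

lemma card_rel_prod_ge:
  assumes p: "p \<in> hall_relations n" and r: "r \<in> hall_relations n"
  shows "card p \<le> card (p \<cdot>\<^sub>r r)"
proof -
  obtain \<tau> where \<tau>: "\<tau> permutes {1..n}" "perm_rel n \<tau> \<subseteq> r"
    using r by (rule hall_relationE)
  then have "p \<cdot>\<^sub>r perm_rel n \<tau> \<subseteq> p \<cdot>\<^sub>r r"
    unfolding rel_prod_def by blast
  then have "card (p \<cdot>\<^sub>r perm_rel n \<tau>) \<le> card (p \<cdot>\<^sub>r r)"
    by (rule card_mono[OF finite_rel_prod[OF p r]])
  then show ?thesis
    unfolding card_rel_prod_perm[OF hall_relation_subset[OF p] \<tau>(1)] .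
qed

text \<open>
  If the product with \<open>r\<close> does not grow, it already equals \<open>p\<close> times each permutation contained
  in \<open>r\<close>; hence \<open>r\<close> intertwines the neighbourhoods in \<open>p\<close> with those in the product.
\<close>
lemma rel_prod_biequiv_hull:
  assumes p: "p \<in> hall_relations n" and r: "r \<in> hall_relations n"
    and card: "card (p \<cdot>\<^sub>r r) = card p"
  shows "p \<cdot>\<^sub>r biequiv_hull n r = p \<cdot>\<^sub>r r"
proof
  define q where "q = p \<cdot>\<^sub>r r"
  have "intertwines r (\<lambda>k. p `` {k}) (\<lambda>m. q `` {m})"
    unfolding intertwines_def
  proof clarify
    fix m k assume mk: "(m, k) \<in> r"
    obtain \<tau> where \<tau>: "\<tau> permutes {1..n}" "perm_rel n \<tau> \<subseteq> r" "\<tau> m = k"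
      using hall_relation_edgeE[OF r mk] .
    have "p \<cdot>\<^sub>r perm_rel n \<tau> \<subseteq> q"
      unfolding q_def rel_prod_def using \<tau>(2) by blast
    then have "p \<cdot>\<^sub>r perm_rel n \<tau> = q"
      using card_rel_prod_perm[OF hall_relation_subset[OF p] \<tau>(1)] card
      by (intro card_subset_eq) (simp_all add: q_def finite_rel_prod[OF p r])
    then have "q `` {m} = (p \<cdot>\<^sub>r perm_rel n \<tau>) `` {m}" by simp
    also have "\<dots> = p `` {k}"
      using mk hall_relation_subset[OF r] \<tau>(3) by (auto simp: mem_rel_perm)
    finally show "q `` {m} = p `` {k}" .
  qed
  then have "q `` {m} = p `` {k}" if "(m, k) \<in> biequiv_hull n r" for m k
    using that unfolding biequiv_hull_def by blast
  then have "p \<cdot>\<^sub>r biequiv_hull n r \<subseteq> q"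
    unfolding rel_prod_def by blast
  then show "p \<cdot>\<^sub>r biequiv_hull n r \<subseteq> p \<cdot>\<^sub>r r"
    unfolding q_def .
  show "p \<cdot>\<^sub>r r \<subseteq> p \<cdot>\<^sub>r biequiv_hull n r"
    using subset_biequiv_hull[OF hall_relation_subset[OF r]] unfolding rel_prod_def by blast
qed

text \<open>The product with \<open>s\<close> lies in the product with the common hull, which is
  \<open>p \<cdot>\<^sub>r r\<close>. It has at least as many pairs as \<open>p\<close>, hence as
  \<open>p \<cdot>\<^sub>r r\<close>.\<close>

lemma rel_prod_eq_of_hull_eq:
  assumes p: "p \<in> hall_relations n" and r: "r \<in> hall_relations n" and s: "s \<in> hall_relations n"
    and card: "card (p \<cdot>\<^sub>r r) = card p" and hull: "biequiv_hull n s = biequiv_hull n r"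
  shows "p \<cdot>\<^sub>r s = p \<cdot>\<^sub>r r"
proof (rule card_seteq[OF finite_rel_prod[OF p r]])
  show "p \<cdot>\<^sub>r s \<subseteq> p \<cdot>\<^sub>r r"
    using rel_prod_biequiv_hull[OF p r card] subset_biequiv_hull[OF hall_relation_subset[OF s]]
    unfolding hull rel_prod_def by blast
  show "card (p \<cdot>\<^sub>r r) \<le> card (p \<cdot>\<^sub>r s)"
    unfolding card by (rule card_rel_prod_ge[OF p s])
qed

text \<open>Fix \<open>P\<close> in the support of \<open>x\<close> and let \<open>Q\<close> have at
  most \<open>k\<close> pairs. The \<open>Y\<close> with \<open>P Y = Q\<close> then form a union of
  full fibres of \<open>hull_map n\<close>; over each fibre \<open>y\<close> sums to zero, so
  \<open>P\<close> contributes nothing to the coefficient at \<open>Q\<close>.\<close>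

lemma kernel_raises_card:
  assumes x: "x \<in> carrier (monoid_algebra (FP n))" and y: "y \<in> carrier (monoid_algebra (FP n))"
    and level: "\<And>X. x X \<noteq> 0 \<Longrightarrow> k \<le> card (class_rel n X)"
    and ker: "push_forward (FP n) (hull_map n) y = (\<lambda>t. 0)"
    and Q: "(x \<otimes>\<^bsub>monoid_algebra (FP n)\<^esub> y) Q \<noteq> 0"
  shows "Suc k \<le> card (class_rel n Q)"
proof (rule ccontr)
  assume small: "\<not> Suc k \<le> card (class_rel n Q)"
  interpret finite_monoid "FP n" by (rule finite_monoid_FP)
  let ?M = "carrier (FP n)"
  have "(\<Sum>Y \<in> ?M. if P \<otimes>\<^bsub>FP n\<^esub> Y = Q then x P * y Y else 0) = 0" if P: "P \<in> ?M" for P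
  proof -
    define S where "S = {Y \<in> ?M. P \<otimes>\<^bsub>FP n\<^esub> Y = Q}"
    have "x P = 0 \<or> (\<Sum>Y \<in> S. y Y) = 0"
    proof (rule disjCI)
      assume "\<not> (\<Sum>Y \<in> S. y Y) = 0"
      note nz = this
      show "x P = 0"
      proof (rule ccontr)
        assume "x P \<noteq> 0"
        note p = class_rel_closed[OF P]
        have saturated: "Y' \<in> S" if "Y \<in> S" "Y' \<in> ?M" "hull_map n Y' = hull_map n Y" for Y Y'
        proof -
          have Y: "Y \<in> ?M" "class_rel n Q = class_rel n P \<cdot>\<^sub>r class_rel n Y"
            using that(1) P class_rel_mult(2) unfolding S_def by auto
          note r = class_rel_closed[OF Y(1)] and s = class_rel_closed[OF that(2)]
          \<comment> \<open>Since \<open>P Y = Q\<close>, the chain of bounds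
            \<open>card Q \<le> k \<le> card P \<le> card (P Y)\<close> collapses.\<close>
          have "card (class_rel n P \<cdot>\<^sub>r class_rel n Y) = card (class_rel n P)"
            using level[OF \<open>x P \<noteq> 0\<close>] small card_rel_prod_ge[OF p r] unfolding Y(2) by simp
          then have "class_rel n (P \<otimes>\<^bsub>FP n\<^esub> Y') = class_rel n Q"
            unfolding class_rel_mult(2)[OF P that(2)] Y(2)
            using that(3) unfolding hull_map_def by (rule rel_prod_eq_of_hull_eq[OF p r s])
          moreover have "Q \<in> ?M"
            using that(1) P unfolding S_def by auto
          ultimately have "P \<otimes>\<^bsub>FP n\<^esub> Y' = Q"
            using inj_onD[OF class_rel_inj] P that(2) by blast
          then show ?thesis
            unfolding S_def using that(2) by blast
        qed
        have "finite S"
          unfolding S_def by simp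
        then have "(\<Sum>Y \<in> S. y Y) = (\<Sum>t \<in> hull_map n ` S. \<Sum>Y \<in> {Y \<in> S. hull_map n Y = t}. y Y)"
          by (intro sum.group[symmetric]) auto
        also have "\<dots> = (\<Sum>t \<in> hull_map n ` S. push_forward (FP n) (hull_map n) y t)"
        proof (rule sum.cong[OF refl])
          fix t assume "t \<in> hull_map n ` S"
          then have "{Y \<in> S. hull_map n Y = t} = {Y \<in> ?M. hull_map n Y = t}"
            using saturated unfolding S_def by auto
          then show "(\<Sum>Y \<in> {Y \<in> S. hull_map n Y = t}. y Y) = push_forward (FP n) (hull_map n) y t"
            by (simp add: push_forward_def)
        qed
        also have "\<dots> = 0"
          unfolding ker by simp
        finally show False
          using nz by simp
      qed
    qed
    moreover have "(\<Sum>Y \<in> ?M. if P \<otimes>\<^bsub>FP n\<^esub> Y = Q then x P * y Y else 0) = x P * (\<Sum>Y \<in> S. y Y)"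
      unfolding S_def by (simp add: sum.inter_filter sum_distrib_left if_distrib cong: if_cong)
    ultimately show ?thesis by auto
  qed
  then have "(x \<otimes>\<^bsub>monoid_algebra (FP n)\<^esub> y) Q = 0"
    unfolding mult_monoid_algebra[OF x y] by (rule sum.neutral[OF ballI])
  then show False
    using Q by simp
qed

text \<open>Each factor \<open>z\<close> raises the lower bound for cardinalities in the support by
  one, and a relation on \<open>{1..n}\<close> has at most \<open>n * n\<close> pairs.\<close>

lemma kernel_nilpotent:
  assumes z: "z \<in> carrier (monoid_algebra (FP n))"
    and ker: "push_forward (FP n) (hull_map n) z = (\<lambda>t. 0)"
  shows "z [^]\<^bsub>monoid_algebra (FP n)\<^esub> Suc (n * n) = \<zero>\<^bsub>monoid_algebra (FP n)\<^esub>"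
proof -
  interpret finite_monoid "FP n" by (rule finite_monoid_FP)
  have level: "k \<le> card (class_rel n X)" if "(z [^]\<^bsub>alg\<^esub> k) X \<noteq> 0" for k :: nat and X
    using that
  proof (induction k arbitrary: X)
    case (Suc k)
    show ?case
      using kernel_raises_card[OF alg.nat_pow_closed[OF z] z Suc.IH ker] Suc.prems by simp
  qed simp
  have "card (class_rel n X) \<le> n * n" if "X \<in> carrier (FP n)" for X
    using card_mono[OF _ hall_relation_subset[OF class_rel_closed[OF that]]] by simp
  moreover have "X \<in> carrier (FP n)" if "(z [^]\<^bsub>alg\<^esub> Suc (n * n)) X \<noteq> 0" for X
    using that alg.nat_pow_closed[OF z] unfolding monoid_algebra_carrier by blast
  ultimately have "(z [^]\<^bsub>alg\<^esub> Suc (n * n)) X = 0" for X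
    using level[of "Suc (n * n)" X] by force
  then show ?thesis by auto
qed

section \<open>Inclusion of the radical in the kernel\<close>

text \<open>At most one summand is nonzero, because \<open>f\<close> and a permutation inside
  \<open>r\<close> determine the middle labelling.\<close>

lemma intertwines_mult_sum:
  assumes r: "r \<in> hall_relations n" and s: "s \<in> hall_relations n"
    and f: "f \<in> {1..n} \<rightarrow>\<^sub>E Pow {1..n}"
  shows "of_bool (intertwines (r \<cdot>\<^sub>r s) f g) =
    (\<Sum>h \<in> {1..n} \<rightarrow>\<^sub>E Pow {1..n}. of_bool (intertwines r f h) * of_bool (intertwines s h g) :: complex)"
proof -
  let ?I = "{1..n} \<rightarrow>\<^sub>E Pow {1..n} :: (nat \<Rightarrow> nat set) set"
  obtain \<tau> where \<tau>: "\<tau> permutes {1..n}" "perm_rel n \<tau> \<subseteq> r"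
    using r by (rule hall_relationE)
  have h_eq: "h j = f (\<tau> j)" if "intertwines r f h" "j \<in> {1..n}" for h j
    using that \<tau>(2) by (intro intertwinesD[OF that(1)]) (auto simp: mem_perm_rel subset_iff)
  \<comment> \<open>Restriction fixes the values outside \<open>{1..n}\<close>, so that
    \<open>h0\<close> is the only candidate in the index set.\<close>
  define h0 where "h0 = restrict (\<lambda>j. f (\<tau> j)) {1..n}"
  have h0: "h0 \<in> ?I"
    unfolding h0_def restrict_PiE_iff using f permutes_in_image[OF \<tau>(1)] by blast
  have eq: "h = h0" if "intertwines r f h" "h \<in> ?I" for h
    using that(2) h0 by (rule PiE_ext) (simp add: h0_def h_eq[OF that(1)])
  have "intertwines (r \<cdot>\<^sub>r s) f g \<longleftrightarrow> intertwines r f h0 \<and> intertwines s h0 g"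
  proof
    assume "intertwines (r \<cdot>\<^sub>r s) f g"
    then obtain h where h: "intertwines r f h" "intertwines s h g"
      using intertwines_mult[OF r s] by blast
    have "h j = h0 j" if "j \<in> {1..n}" for j
      using h_eq[OF h(1) that] that by (simp add: h0_def)
    then show "intertwines r f h0 \<and> intertwines s h0 g"
      using h intertwines_cong[OF hall_relation_subset[OF r], of f f h h0]
        intertwines_cong[OF hall_relation_subset[OF s], of h h0 g g] by blast
  qed (use intertwines_mult[OF r s] in blast)
  moreover have "(\<Sum>h \<in> ?I. of_bool (intertwines r f h) * of_bool (intertwines s h g)) =
      (\<Sum>h \<in> {h0}. of_bool (intertwines r f h0 \<and> intertwines s h0 g) :: complex)"
  proof (rule sum.mono_neutral_cong_right)
    have "\<not> intertwines r f h" if "h \<in> ?I - {h0}" for h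
      using that eq by blast
    then show "\<forall>h \<in> ?I - {h0}. of_bool (intertwines r f h) * of_bool (intertwines s h g) = (0 :: complex)"
      by simp
  qed (use h0 in \<open>simp_all add: finite_PiE of_bool_conj\<close>)
  ultimately show ?thesis by simp
qed

text \<open>All matrix entries of \<open>x\<close> vanish. Those at block labellings are sums of
  image coefficients over the elements below \<open>t\<close>, a system that is triangular for
  inclusion.\<close>

lemma jacobson_radical_FP_subset:
  assumes x: "x \<in> jacobson_radical (monoid_algebra (FP n))"
  shows "push_forward (FP n) (hull_map n) x = (\<lambda>t. 0)"
proof -
  interpret finite_monoid "FP n" by (rule finite_monoid_FP)
  interpret N: finite_monoid "factorizable_dual n" by (rule finite_monoid_factorizable_dual)
  \<comment> \<open>A finite index set of labellings, with values rich enough for blocks and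
    neighbourhoods.\<close>
  let ?I = "{1..n} \<rightarrow>\<^sub>E Pow {1..n} :: (nat \<Rightarrow> nat set) set"
  have \<phi>: "hull_map n \<in> carrier (FP n) \<rightarrow> carrier (factorizable_dual n)"
    using hull_map_surj by blast
  note push = pairing_push_forward[OF N.finite_monoid_axioms \<phi>]
    push_forward_closed[OF N.finite_monoid_axioms \<phi>]
  have matrix: "pairing (FP n) x (\<lambda>X. of_bool (intertwines (class_rel n X) f g)) = 0"
    if fg: "f \<in> ?I" "g \<in> ?I" for f g
  proof (rule jacobson_radical_matrix_rep[OF _ _ _ x fg])
    show "finite ?I"
      by (simp add: finite_PiE)
    show "(of_bool (intertwines (class_rel n (X \<otimes>\<^bsub>FP n\<^esub> Y)) f g) :: complex) =
      (\<Sum>h \<in> ?I. of_bool (intertwines (class_rel n X) f h) * of_bool (intertwines (class_rel n Y) h g))"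
      if "X \<in> carrier (FP n)" "Y \<in> carrier (FP n)" "f \<in> ?I" "g \<in> ?I" for X Y f g
      unfolding class_rel_mult(2)[OF that(1,2)]
      by (rule intertwines_mult_sum[OF class_rel_closed class_rel_closed]) (rule that)+
    show "\<exists>Y \<in> carrier (FP n). \<forall>f \<in> ?I. \<forall>g \<in> ?I. of_bool (intertwines (class_rel n Y) f g) =
        cnj (of_bool (intertwines (class_rel n X) g f))" if X: "X \<in> carrier (FP n)" for X
    proof -
      \<comment> \<open>The entries are real, so the transpose given by the converse relation is the
        adjoint.\<close>
      obtain Y where "Y \<in> carrier (FP n)" "class_rel n Y = (class_rel n X)\<inverse>"
        using hall_relation_converse[OF class_rel_closed[OF X]] unfolding class_rel_image[symmetric] by force
      then show ?thesis
        by (intro bexI[of _ Y]) (simp_all add: intertwines_converse)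
    qed
  qed
  define v where "v = push_forward (FP n) (hull_map n) x"
  have vanish: "v t = 0" if "t \<in> carrier (factorizable_dual n)" for t
    using that
  proof (induction "card t" arbitrary: t rule: less_induct)
    case less
    obtain \<rho> \<sigma> where t: "equiv {1..n} \<rho>" "\<sigma> permutes {1..n}" "t = \<rho> \<cdot>\<^sub>r perm_rel n \<sigma>"
      using less.prems factorizable_dual_carrier by blast
    have t_hall: "t \<in> hall_relations n"
      using less.prems factorizable_dual_subset_hall by blast
    define f where "f = restrict (\<lambda>k. \<rho> `` {k}) {1..n}"
    define g where "g = restrict (\<lambda>m. t `` {m}) {1..n}"
    have "f \<in> ?I" "g \<in> ?I"
      using t(1) hall_relation_subset[OF t_hall]
      unfolding f_def g_def restrict_PiE_iff by (auto simp: equiv_def)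
    have "intertwines (class_rel n X) f g \<longleftrightarrow> hull_map n X \<subseteq> t" if X: "X \<in> carrier (FP n)" for X
    proof -
      have r: "class_rel n X \<subseteq> {1..n} \<times> {1..n}"
        by (rule hall_relation_subset[OF class_rel_closed[OF X]])
      have "intertwines (class_rel n X) f g \<longleftrightarrow>
          intertwines (class_rel n X) (\<lambda>k. \<rho> `` {k}) (\<lambda>m. t `` {m})"
        by (rule intertwines_cong[OF r]) (simp_all add: f_def g_def)
      also have "\<dots> \<longleftrightarrow> class_rel n X \<subseteq> t"
        by (rule intertwines_factorizable_dual[OF t r])
      also have "\<dots> \<longleftrightarrow> hull_map n X \<subseteq> t"
        unfolding hull_map_def
        using subset_biequiv_hull[OF r] biequiv_hull_mono[of "class_rel n X" t n]
          biequiv_hull_factorizable_dual[OF less.prems] by blast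
      finally show ?thesis .
    qed
    \<comment> \<open>The entry at the block labellings of \<open>t\<close> is the sum of
      \<open>v u\<close> over \<open>u \<subseteq> t\<close>; by induction the proper
      \<open>u\<close> contribute nothing.\<close>
    then have "0 = pairing (FP n) x (\<lambda>X. of_bool (hull_map n X \<subseteq> t))"
      using matrix[OF \<open>f \<in> ?I\<close> \<open>g \<in> ?I\<close>] by (simp cong: pairing_cong)
    also have "\<dots> = (\<Sum>u \<in> carrier (factorizable_dual n). v u * of_bool (u \<subseteq> t))"
      using push(1)[of x "\<lambda>u. of_bool (u \<subseteq> t)"] by (simp only: v_def pairing_def)
    also have "\<dots> = (\<Sum>u \<in> {t}. v u)"
    proof (rule sum.mono_neutral_cong_right)
      show "\<forall>u \<in> carrier (factorizable_dual n) - {t}. v u * of_bool (u \<subseteq> t) = 0"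
      proof
        fix u assume u: "u \<in> carrier (factorizable_dual n) - {t}"
        have "v u = 0" if "u \<subseteq> t"
        proof (rule less.hyps)
          show "card u < card t"
            using that u finite_hall_relation[OF t_hall] by (intro psubset_card_mono) auto
        qed (use u in blast)
        then show "v u * of_bool (u \<subseteq> t) = 0" by auto
      qed
    qed (use less.prems in auto)
    finally show ?case by simp
  qed
  have "v t = 0" for t
    using vanish push(2)[of x] unfolding v_def[symmetric] N.monoid_algebra_carrier by blast
  then show ?thesis
    unfolding v_def by blast
qed

text \<open>The kernel is a nil ideal and so lies in the radical; the other inclusion comes from the
  matrix representation.\<close>

lemma jacobson_radical_FP:
  "jacobson_radical (monoid_algebra (FP n)) =
    a_kernel (monoid_algebra (FP n)) (monoid_algebra (factorizable_dual n))
      (push_forward (FP n) (hull_map n))"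
proof -
  interpret finite_monoid "FP n" by (rule finite_monoid_FP)
  interpret N: finite_monoid "factorizable_dual n" by (rule finite_monoid_factorizable_dual)
  let ?\<Phi> = "push_forward (FP n) (hull_map n)"
  interpret \<Phi>: ring_hom_ring alg N.alg ?\<Phi>
    by (intro ring_hom_ringI2 ring_monoid_algebra N.ring_monoid_algebra
      push_forward_ring_hom N.finite_monoid_axioms hull_map_hom hull_map_one)
  have ker: "z \<in> a_kernel alg N.alg ?\<Phi> \<longleftrightarrow> z \<in> carrier alg \<and> ?\<Phi> z = (\<lambda>t. 0)" for z
    unfolding a_kernel_def' by (simp only: mem_Collect_eq zero_monoid_algebra)
  have "a_kernel alg N.alg ?\<Phi> \<subseteq> jacobson_radical alg"
  proof (rule alg.nil_left_ideal_subset_jacobson_radical)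
    show "left_ideal (a_kernel alg N.alg ?\<Phi>) alg"
      using \<Phi>.kernel_is_ideal by (simp add: left_ideal_def ideal_def ideal_axioms_def)
    show "\<exists>N::nat. z [^]\<^bsub>alg\<^esub> N = \<zero>\<^bsub>alg\<^esub>" if "z \<in> a_kernel alg N.alg ?\<Phi>" for z
      using that kernel_nilpotent unfolding ker by blast
  qed
  moreover have "jacobson_radical alg \<subseteq> a_kernel alg N.alg ?\<Phi>"
    using jacobson_radical_FP_subset unfolding ker subset_iff
    by (auto simp only: ker jacobson_radical_def)
  ultimately show ?thesis by blast
qed

theorem theorem19:
  fixes n :: nat
  assumes "n \<ge> 1"
  shows "is_algebra_iso
    (quotient_algebra (monoid_algebra (FP n)) (jacobson_radical (monoid_algebra (FP n))))
    (monoid_algebra (factorizable_dual n))"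
proof -
  interpret finite_monoid "FP n" by (rule finite_monoid_FP)
  interpret N: finite_monoid "factorizable_dual n" by (rule finite_monoid_factorizable_dual)
  show ?thesis
    unfolding jacobson_radical_FP
  proof (rule quotient_algebra_kernel_iso)
    show "ring_hom_ring alg N.alg (push_forward (FP n) (hull_map n))"
      by (intro ring_hom_ringI2 ring_monoid_algebra N.ring_monoid_algebra
        push_forward_ring_hom N.finite_monoid_axioms hull_map_hom hull_map_one)
    show "push_forward (FP n) (hull_map n) ` carrier alg = carrier N.alg"
      by (rule push_forward_surj[OF N.finite_monoid_axioms hull_map_surj])
  qed (simp_all add: smult_closed_monoid_algebra push_forward_scale)
qed

end
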